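(* Let $P$ be a $d$-dimensional reflexive polytope and let $z\in\mathbb{C}$ be a root of $L_P$. The inequality $$-\frac{d}{2}\leq\operatorname{Re}(z)\leq\frac{d}{2}-1$$ holds when $d\leq 5$, or for arbitrary $d$ when $P$ is real.
   Context: A $d$-dimensional lattice polytope is a full-dimensional convex polytope $P\subset\mathbb{Z}^d\otimes_{\mathbb{Z}}\mathbb{Q}$ with vertices in $\mathbb{Z}^d$. It is reflexive if its dual $P^*:=\{u\in\mathbb{Z}^d\otimes_{\mathbb{Z}}\mathbb{Q}\mid\langle u,v\rangle\geq -1\text{ for all }v\in P\}$ is also a lattice polytope. The Ehrhart polynomial $L_P$ is the degree-$d$ polynomial with $L_P(m)=|mP\cap\mathbb{Z}^d|$ for all integers $m\geq 0$, regarded as a polynomial over $\mathbb{C}$. $P$ is real if every root $z\in\mathbb{C}$ of $L_P$ satisfies $\operatorname{Im}(z)=0$. *)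

theory Defs
  imports "HOL-Analysis.Analysis" "HOL-Computational_Algebra.Polynomial"
begin

text \<open>
  The dimension is \<open>d = CARD('n)\<close>. Lattice polytopes are represented by their real
  points, so that the library notions of polytope and extreme point apply; as the vertices
  are integral, this carries the same data as the set of rational points.
\<close>

definition integer_lattice :: "(real ^ 'n) set" where
  "integer_lattice = {x. \<forall>i. x $ i \<in> \<int>}"

definition lattice_polytope :: "(real ^ 'n) set \<Rightarrow> bool" where
  "lattice_polytope P \<longleftrightarrow>
     polytope P \<and> aff_dim P = int CARD('n) \<and>
     (\<forall>v. v extreme_point_of P \<longrightarrow> v \<in> integer_lattice)"

definition dual_polytope :: "(real ^ 'n) set \<Rightarrow> (real ^ 'n) set" where
  "dual_polytope P = {u. \<forall>v\<in>P. u \<bullet> v \<ge> -1}"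

definition reflexive :: "(real ^ 'n) set \<Rightarrow> bool" where
  "reflexive P \<longleftrightarrow> lattice_polytope P \<and> lattice_polytope (dual_polytope P)"

definition is_ehrhart_polynomial :: "(real ^ 'n) set \<Rightarrow> complex poly \<Rightarrow> bool" where
  "is_ehrhart_polynomial P L \<longleftrightarrow>
     degree L = CARD('n) \<and>
     (\<forall>m::nat. poly L (of_nat m) =
        of_nat (card ((\<lambda>x. real m *\<^sub>R x) ` P \<inter> integer_lattice)))"

text \<open>
  The description below is meaningful for lattice polytopes: existence is Ehrhart's theorem,
  uniqueness is the following lemma.
\<close>

lemma is_ehrhart_polynomial_unique:
  assumes "is_ehrhart_polynomial P L" and "is_ehrhart_polynomial P M"
  shows "L = M"
proof (rule ccontr)
  assume "L \<noteq> M"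
  then have "finite {z. poly (L - M) z = 0}"
    by (intro poly_roots_finite) simp
  moreover have "range (of_nat :: nat \<Rightarrow> complex) \<subseteq> {z. poly (L - M) z = 0}"
    using assms by (auto simp: is_ehrhart_polynomial_def)
  ultimately have "finite (range (of_nat :: nat \<Rightarrow> complex))"
    by (rule rev_finite_subset)
  then show False
    using range_inj_infinite[OF inj_of_nat] by blast
qed

definition ehrhart_polynomial :: "(real ^ 'n) set \<Rightarrow> complex poly" where
  "ehrhart_polynomial P = (THE L. is_ehrhart_polynomial P L)"

definition real_polytope :: "(real ^ 'n) set \<Rightarrow> bool" where
  "real_polytope P \<longleftrightarrow> (\<forall>z. poly (ehrhart_polynomial P) z = 0 \<longrightarrow> Im z = 0)"

end

theory Submission
  imports Defs
begin

text \<open>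
  Since every facet of a reflexive polytope lies at lattice distance one from the origin, a
  lattice point in the cone over a facet has an integral height, and it belongs to the dilate
  \<open>m P\<close> iff its height is at most \<open>m\<close>. Triangulating the boundary (by a generic perturbation of
  the linear program that computes the height) and shifting by a generic vector \<open>q\<close> cuts space
  into half-open simplicial cones. Counting in each cone gives
  \<open>L m = (\<Sum>j\<le>d. h j * ((m + d - j) choose d))\<close>, where \<open>h j\<close> is the number of points of height \<open>j\<close> in
  the half-open fundamental boxes. Replacing \<open>q\<close> by \<open>- q\<close> and a box point by its reflection
  turns \<open>h j\<close> into \<open>h (d - j)\<close>, so \<open>h\<close> is symmetric.

  The symmetry gives \<open>L (- 1 - z) = (- 1) ^ d * L z\<close>, and for real \<open>r > d / 2 - 1\<close> the terms \<open>j\<close> and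
  \<open>d - j\<close> have a nonnegative sum, which bounds the real roots in every dimension. For \<open>d \<le> 5\<close> the
  polynomial is, up to a factor \<open>z + 1 / 2\<close>, at most quadratic in \<open>(z + 1 / 2)\<^sup>2\<close>, and the nonreal
  roots are bounded by its coefficients.
\<close>

section \<open>Polynomials with a symmetric h*-vector\<close>

text \<open>The summand for \<open>j\<close> is \<open>h j\<close> times \<open>x + d - j\<close>
  choose \<open>d\<close>, spelled out in linear factors so that one vector gives a polynomial over
  the reals as well as over the complex numbers.\<close>

definition hstar_poly :: "nat \<Rightarrow> (nat \<Rightarrow> nat) \<Rightarrow> 'a::field_char_0 poly" where
  "hstar_poly d h =
     (\<Sum>j\<le>d. smult (of_nat (h j) / fact d) (\<Prod>i<d. [:of_nat d - of_nat j - of_nat i, 1:]))"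

lemma poly_hstar_poly:
  "poly (hstar_poly d h) x =
     (\<Sum>j\<le>d. of_nat (h j) * (\<Prod>i<d. x + of_nat d - of_nat j - of_nat i)) / fact d"
  by (simp add: hstar_poly_def poly_sum poly_prod sum_divide_distrib algebra_simps)

lemma poly_hstar_poly_of_nat:
  "poly (hstar_poly d h) (of_nat m :: 'a::field_char_0) = of_nat (\<Sum>j\<le>d. h j * ((m + d - j) choose d))"
proof -
  have "(\<Prod>i<d. of_nat m + of_nat d - of_nat j - of_nat i :: 'a) = fact d * of_nat ((m + d - j) choose d)"
    if "j \<le> d" for j
  proof -
    have "of_nat (m + d - j) gchoose d = (\<Prod>i<d. of_nat (m + d - j) - of_nat i :: 'a) / fact d"
      by (simp add: gbinomial_prod_rev atLeast0LessThan)
    then show ?thesis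
      using that by (simp add: binomial_gbinomial of_nat_diff)
  qed
  then show ?thesis
    by (simp add: poly_hstar_poly sum_divide_distrib)
qed

text \<open>The summands have degree \<open>d\<close> and leading coefficients
  \<open>h j / fact d\<close>, which cannot cancel because the \<open>h j\<close> are natural
  numbers.\<close>

lemma degree_hstar_poly:
  assumes "(\<Sum>j\<le>d. h j) > 0"
  shows "degree (hstar_poly d h :: 'a::field_char_0 poly) = d"
proof (rule antisym)
  have deg: "degree (\<Prod>i<d. [:of_nat d - of_nat j - of_nat i, 1 :: 'a:]) = d" for j
    by (subst degree_prod_sum_eq) auto
  show "degree (hstar_poly d h :: 'a poly) \<le> d"
    unfolding hstar_poly_def by (intro degree_sum_le) (auto simp: deg)
  have "coeff (\<Prod>i<d. [:of_nat d - of_nat j - of_nat i, 1 :: 'a:]) d = 1" for j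
    using lead_coeff_prod[of "\<lambda>i. [:of_nat d - of_nat j - of_nat i, 1 :: 'a:]" "{..<d}"]
    by (simp add: deg)
  then have "coeff (hstar_poly d h :: 'a poly) d = of_nat (\<Sum>j\<le>d. h j) / fact d"
    by (simp add: hstar_poly_def coeff_sum sum_divide_distrib)
  with assms have "coeff (hstar_poly d h :: 'a poly) d \<noteq> 0"
    by (metis divide_eq_0_iff fact_nonzero less_irrefl of_nat_eq_0_iff)
  then show "d \<le> degree (hstar_poly d h :: 'a poly)"
    by (rule le_degree)
qed

text \<open>Substituting \<open>- 1 - x\<close> turns the linear factors of the summand for
  \<open>j\<close> into the negatives of those for \<open>d - j\<close>, in reverse order.\<close>

lemma poly_hstar_poly_reflect:
  assumes "\<And>j. j \<le> d \<Longrightarrow> h (d - j) = h j"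
  shows "poly (hstar_poly d h) (- 1 - x) = (- 1) ^ d * poly (hstar_poly d h) x"
proof -
  have *: "(\<Prod>i<d. (- 1 - x) + of_nat d - of_nat j - of_nat i) =
      (- 1) ^ d * (\<Prod>i<d. x + of_nat d - of_nat (d - j) - of_nat i)" if "j \<le> d" for j
  proof -
    have "(\<Prod>i<d. (- 1 - x) + of_nat d - of_nat j - of_nat i) =
        (\<Prod>i<d. - 1 * (x + of_nat d - of_nat (d - j) - of_nat (d - Suc i)))"
      using that by (intro prod.cong) (auto simp: of_nat_diff algebra_simps)
    also have "\<dots> = (- 1) ^ d * (\<Prod>i<d. x + of_nat d - of_nat (d - j) - of_nat (d - Suc i))"
      by (subst prod.distrib) simp
    finally show ?thesis
      by (simp only: prod.nat_diff_reindex[of "\<lambda>i. x + of_nat d - of_nat (d - j) - of_nat i"])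
  qed
  have "(\<Sum>j\<le>d. of_nat (h j) * (\<Prod>i<d. (- 1 - x) + of_nat d - of_nat j - of_nat i)) =
      (\<Sum>j\<le>d. of_nat (h (d - j)) * ((- 1) ^ d * (\<Prod>i<d. x + of_nat d - of_nat (d - j) - of_nat i)))"
    by (intro sum.cong refl) (simp only: atMost_iff * assms)
  also have "\<dots> = (\<Sum>j\<le>d. of_nat (h j) * ((- 1) ^ d * (\<Prod>i<d. x + of_nat d - of_nat j - of_nat i)))"
    using sum.nat_diff_reindex[of "\<lambda>j. of_nat (h j) * ((- 1) ^ d * (\<Prod>i<d. x + of_nat d - of_nat j - of_nat i))" "Suc d"]
    by (simp add: lessThan_Suc_atMost)
  finally show ?thesis
    by (simp add: poly_hstar_poly sum_distrib_left mult_ac)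
qed

text \<open>
  The factors common to both products are positive; the remaining ones are \<open>r + k\<close> on the
  right and \<open>r + 1 - k\<close> on the left, for \<open>j < k \<le> d - j\<close>.
\<close>

lemma abs_falling_product_le:
  fixes r :: real
  assumes j: "2 * j \<le> d" and r: "r > real d / 2 - 1" "d \<ge> 1"
  shows "\<bar>\<Prod>i<d. r + real j - real i\<bar> \<le> (\<Prod>i<d. r + real d - real j - real i)"
    and "j = 0 \<Longrightarrow> \<bar>\<Prod>i<d. r - real i\<bar> < (\<Prod>i<d. r + real d - real i)"
proof -
  define c where "c = (\<Prod>i<2 * j. r + real j - real i)"
  \<comment> \<open>The smallest factor is \<open>r - j + 1\<close>, positive since
    \<open>r > d / 2 - 1\<close> and \<open>2 * j \<le> d\<close>; for \<open>j = 0\<close> the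
    product is empty.\<close>
  have c: "c > 0"
    unfolding c_def using j r by (intro prod_pos) auto
  have "{..<d} = {..<2 * j} \<union> {2 * j..<d}" "{..<d} = {..<d - 2 * j} \<union> {d - 2 * j..<d}"
    using j by auto
  note split = prod.union_disjoint[of "{..<2 * j}" "{2 * j..<d}", folded this(1)]
    prod.union_disjoint[of "{..<d - 2 * j}" "{d - 2 * j..<d}", folded this(2)]
  have left: "(\<Prod>i<d. r + real j - real i) = c * (\<Prod>k<d - 2 * j. r - real j - real k)"
  proof -
    have "(\<Prod>i\<in>{2 * j..<d}. r + real j - real i) = (\<Prod>k<d - 2 * j. r - real j - real k)"
      by (rule prod.reindex_bij_witness[of _ "\<lambda>k. k + 2 * j" "\<lambda>i. i - 2 * j"]) (auto simp: of_nat_diff)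
    then show ?thesis
      unfolding c_def by (subst split(1)) auto
  qed
  have right: "(\<Prod>i<d. r + real d - real j - real i) = c * (\<Prod>k<d - 2 * j. r + 1 + real j + real k)"
  proof -
    have "(\<Prod>i\<in>{d - 2 * j..<d}. r + real d - real j - real i) = c"
      unfolding c_def using j
      by (intro prod.reindex_bij_witness[of _ "\<lambda>k. k + (d - 2 * j)" "\<lambda>i. i - (d - 2 * j)"]) (auto simp: of_nat_diff)
    moreover have "(\<Prod>i<d - 2 * j. r + real d - real j - real i) = (\<Prod>k<d - 2 * j. r + 1 + real j + real k)"
      using j by (intro prod.reindex_bij_witness[of _ "\<lambda>k. d - 2 * j - Suc k" "\<lambda>i. d - 2 * j - Suc i"]) (auto simp: of_nat_diff)
    ultimately show ?thesis
      by (subst split(2)) auto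
  qed
  \<comment> \<open>As \<open>d \<ge> 1\<close> gives \<open>r > - 1 / 2\<close>, the point
    \<open>r\<close> is closer to \<open>j + k\<close> than to its mirror image
    \<open>- 1 - j - k\<close>.\<close>
  have lt: "\<bar>r - real j - real k\<bar> < r + 1 + real j + real k" for k
    using r by (auto simp: abs_if)
  show "\<bar>\<Prod>i<d. r + real j - real i\<bar> \<le> (\<Prod>i<d. r + real d - real j - real i)"
    unfolding left right abs_mult abs_prod using c lt
    by (intro mult_mono prod_mono) (auto intro: less_imp_le prod_nonneg)
  assume "j = 0"
  then have "\<bar>\<Prod>i<d. r - real i\<bar> < (\<Prod>k<d. r + 1 + real k)"
    unfolding abs_prod using lt r
    by (intro prod_mono_strict[of 0]) (auto intro: less_imp_le)
  then show "\<bar>\<Prod>i<d. r - real i\<bar> < (\<Prod>i<d. r + real d - real i)"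
    using right \<open>j = 0\<close> by (simp add: c_def)
qed

text \<open>The terms \<open>j\<close> and \<open>d - j\<close> have equal weights, and the one that
  may be negative is dominated by the other. The pair of \<open>0\<close> and \<open>d\<close>
  contributes strictly.\<close>

lemma poly_hstar_poly_pos:
  fixes r :: real
  assumes sym: "\<And>j. j \<le> d \<Longrightarrow> h (d - j) = h j" and "h 0 > 0"
    and r: "r > real d / 2 - 1" "d \<ge> 1"
  shows "poly (hstar_poly d h) r > 0"
proof -
  define G where "G j = (\<Prod>i<d. r + real d - real j - real i)" for j
  have pair: "G j + G (d - j) \<ge> 0" if "2 * j \<le> d" for j
  proof -
    have "G (d - j) = (\<Prod>i<d. r + real j - real i)"
      using that by (simp add: G_def of_nat_diff)
    with abs_falling_product_le(1)[OF that r] show ?thesis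
      unfolding G_def by linarith
  qed
  have nonneg: "G j + G (d - j) \<ge> 0" if "j \<le> d" for j
    using pair[of j] pair[of "d - j"] that by (cases "2 * j \<le> d") (auto simp: add.commute)
  have pos: "G 0 + G d > 0"
    using abs_falling_product_le(2)[of 0 d r] r unfolding G_def by auto
  \<comment> \<open>Adding the sum to its reversal forms every pair twice, so a middle index needs
    no separate case.\<close>
  have "(\<Sum>j\<le>d. h j * G j) = (\<Sum>j\<le>d. h j * G (d - j))"
    using sum.nat_diff_reindex[of "\<lambda>j. h j * G j" "Suc d"] sym
    by (simp add: lessThan_Suc_atMost)
  then have "2 * (\<Sum>j\<le>d. h j * G j) = (\<Sum>j\<le>d. h j * (G j + G (d - j)))"
    by (simp add: distrib_left sum.distrib)
  also have "\<dots> > 0"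
    using nonneg pos assms by (intro sum_pos2[of _ 0]) auto
  finally show ?thesis
    by (simp add: poly_hstar_poly G_def)
qed

text \<open>Positivity gives the upper bound, and the reflection of \<open>r\<close> to
  \<open>- 1 - r\<close> exchanges the two ends of the interval.\<close>

lemma hstar_poly_real_root_bounds:
  fixes r :: real
  assumes sym: "\<And>j. j \<le> d \<Longrightarrow> h (d - j) = h j" and "h 0 > 0" "d \<ge> 1"
    and root: "poly (hstar_poly d h) r = 0"
  shows "- (real d / 2) \<le> r" "r \<le> real d / 2 - 1"
proof -
  show "r \<le> real d / 2 - 1"
    using poly_hstar_poly_pos[OF sym \<open>h 0 > 0\<close>, of r] assms by force
  have "poly (hstar_poly d h) (- 1 - r) = 0"
    using poly_hstar_poly_reflect[of d h r] sym root by simp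
  then have "\<not> - 1 - r > real d / 2 - 1"
    using poly_hstar_poly_pos[OF sym \<open>h 0 > 0\<close>, of "- 1 - r"] assms by force
  then show "- (real d / 2) \<le> r"
    by linarith
qed

section \<open>Bounds for complex roots\<close>

lemma poly_hstar_poly_of_real:
  "poly (hstar_poly d h) (complex_of_real r) = of_real (poly (hstar_poly d h) r)"
  by (simp add: poly_hstar_poly)

text \<open>As \<open>x\<close> and \<open>y\<close> are nonzero, \<open>u\<close> is not real, so
  the quadratic has the roots \<open>u\<close> and its conjugate. The conclusions are Vieta's
  formulas for their sum and product.\<close>

lemma quadratic_nonreal_root:
  fixes A B C x y :: real
  assumes A: "A > 0" and root: "of_real A * u\<^sup>2 + of_real B * u + of_real C = 0" "u = (Complex x y)\<^sup>2"
    and "x \<noteq> 0" "y \<noteq> 0"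
  shows "2 * A * (x\<^sup>2 - y\<^sup>2) + B = 0" "A * (x\<^sup>2 + y\<^sup>2)\<^sup>2 = C"
proof -
  have u: "Re u = x\<^sup>2 - y\<^sup>2" "Im u = 2 * x * y"
    using root(2) by (auto simp: power2_eq_square)
  have "Im u * (2 * A * Re u + B) = 0"
    using arg_cong[OF root(1), of Im] by (simp add: power2_eq_square algebra_simps)
  then show *: "2 * A * (x\<^sup>2 - y\<^sup>2) + B = 0"
    using u assms by simp
  have "A * ((Re u)\<^sup>2 - (Im u)\<^sup>2) + B * Re u + C = 0"
    using arg_cong[OF root(1), of Re] by (simp add: power2_eq_square algebra_simps)
  moreover have "(x\<^sup>2 + y\<^sup>2)\<^sup>2 = (Re u)\<^sup>2 + (Im u)\<^sup>2"
    unfolding u by (simp add: power2_eq_square algebra_simps)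
  moreover have "B = - 2 * A * Re u"
    using * u by simp
  ultimately show "A * (x\<^sup>2 + y\<^sup>2)\<^sup>2 = C"
    by (simp add: power2_eq_square algebra_simps)
qed

text \<open>Vieta's formulas combine to
  \<open>4 * A * x\<^sup>2 + B = 2 * A * (x\<^sup>2 + y\<^sup>2)\<close>, whose square is
  \<open>4 * A * C\<close>. An \<open>x\<close> beyond \<open>s\<close> would make this square too
  large.\<close>

lemma quadratic_nonreal_root_bound:
  fixes A B C x y s :: real
  assumes A: "A > 0" and root: "of_real A * u\<^sup>2 + of_real B * u + of_real C = 0" "u = (Complex x y)\<^sup>2"
    and "x \<noteq> 0" "y \<noteq> 0" "s \<ge> 0"
    and pos: "4 * A * s\<^sup>2 + B \<ge> 0" and C: "4 * A * C \<le> (4 * A * s\<^sup>2 + B)\<^sup>2"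
  shows "\<bar>x\<bar> \<le> s"
proof (rule ccontr)
  note eqs = quadratic_nonreal_root[OF assms(1-5)]
  assume "\<not> \<bar>x\<bar> \<le> s"
  then have "s\<^sup>2 < x\<^sup>2"
    using \<open>s \<ge> 0\<close> by (metis abs_of_nonneg linorder_not_le power2_abs power2_less_imp_less power_mono abs_le_square_iff)
  then have "4 * A * s\<^sup>2 + B < 4 * A * x\<^sup>2 + B"
    using A by simp
  also have "\<dots> = 2 * A * (x\<^sup>2 + y\<^sup>2)"
    using eqs(1) by (simp add: algebra_simps)
  finally have "(4 * A * s\<^sup>2 + B)\<^sup>2 < (2 * A * (x\<^sup>2 + y\<^sup>2))\<^sup>2"
    using pos by (intro power_strict_mono) auto
  also have "\<dots> = 4 * A * (A * (x\<^sup>2 + y\<^sup>2)\<^sup>2)"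
    by (simp add: power2_eq_square algebra_simps)
  finally show False
    using C eqs(2) by simp
qed

text \<open>In the centred variable \<open>z + 1 / 2\<close> the reflection is a sign change, so the
  polynomial is even or odd. For \<open>d \<le> 3\<close> the part in \<open>u\<close> is at most
  linear and has real roots only, which puts \<open>z + 1 / 2\<close> on an axis.\<close>

lemma hstar_poly_root_bounds:
  assumes sym: "\<And>j. j \<le> d \<Longrightarrow> h (d - j) = h j" and h0: "h 0 = 1" "d \<ge> 1"
    and root: "poly (hstar_poly d h) z = 0" and d: "d \<le> 5 \<or> Im z = 0"
  shows "- (real d / 2) \<le> Re z" "Re z \<le> real d / 2 - 1"
proof -
  define x y where "x = Re z + 1 / 2" and "y = Im z"
  define u where "u = (Complex x y)\<^sup>2"
  define H where "H i = real (h i)" for i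
  have H: "H i \<ge> 0" for i by (simp add: H_def)
  have H0: "H 0 = 1" and Hsym: "j \<le> d \<Longrightarrow> H (d - j) = H j" for j
    using sym h0 by (auto simp: H_def)
  have hH: "of_nat (h i) = complex_of_real (H i)" for i by (simp add: H_def)
  have z: "z = Complex x y - 1 / 2"
    by (simp add: x_def y_def complex_eq_iff)
  \<comment> \<open>Both bounds together say that \<open>x\<close> is at most
    \<open>(d - 1) / 2\<close> in absolute value. On the axes this is trivial (\<open>x = 0\<close>)
    or the bound for real roots (\<open>y = 0\<close>).\<close>
  have "\<bar>x\<bar> \<le> (real d - 1) / 2" if "x \<noteq> 0" "y \<noteq> 0"
  proof -
    have "d \<in> {1, 2, 3, 4, 5}"
      using d h0 that by (auto simp: y_def)
    have "Complex x y \<noteq> 0" "Im u \<noteq> 0"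
      using that by (auto simp: u_def power2_eq_square complex_eq_iff)
    have no_linear: "of_real a * u + of_real b \<noteq> 0" if "a \<noteq> 0" for a b
      using \<open>Im u \<noteq> 0\<close> that by (auto simp: complex_eq_iff)
    consider "d = 1" | "d = 2" | "d = 3" | "d = 4" | "d = 5"
      using \<open>d \<in> {1, 2, 3, 4, 5}\<close> by auto
    then show ?thesis
    proof cases
      case 1
      have "poly (hstar_poly d h) z = 2 * Complex x y"
        using Hsym[of 0] unfolding z \<open>d = 1\<close>
        by (simp add: poly_hstar_poly hH H0 algebra_simps)
      then show ?thesis
        using root \<open>Complex x y \<noteq> 0\<close> by simp
    next
      case 2
      have "2 * poly (hstar_poly d h) z = of_real (2 + H 1) * u + of_real (3 / 2 - H 1 / 4)"
        using Hsym[of 0] unfolding z \<open>d = 2\<close> u_def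
        by (simp add: poly_hstar_poly eval_nat_numeral hH H0 field_simps)
      moreover have "2 + H 1 \<noteq> 0"
        using H[of 1] by linarith
      ultimately show ?thesis
        using no_linear[of "2 + H 1" "3 / 2 - H 1 / 4"] root by simp
    next
      case 3
      have "6 * poly (hstar_poly d h) z =
          2 * Complex x y * (of_real (1 + H 1) * u + of_real (23 / 4 - H 1 / 4))"
        using Hsym[of 0] Hsym[of 1] unfolding z \<open>d = 3\<close> u_def
        by (simp add: poly_hstar_poly eval_nat_numeral hH H0 field_simps)
      moreover have "1 + H 1 \<noteq> 0"
        using H[of 1] by linarith
      ultimately show ?thesis
        using no_linear[of "1 + H 1" "23 / 4 - H 1 / 4"] root \<open>Complex x y \<noteq> 0\<close> by simp
    next
      case 4
      \<comment> \<open>Coefficients in \<open>u\<close> after clearing the denominator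
        \<open>fact 4\<close>; by symmetry and \<open>h 0 = 1\<close> only \<open>H 1\<close> and
        \<open>H 2\<close> remain free, and \<open>A\<close> is the sum of all
        \<open>h j\<close>.\<close>
      define A B C where "A = 2 + 2 * H 1 + H 2" and "B = 43 + 7 * H 1 - 5 / 2 * H 2"
        and "C = 105 / 8 - 15 / 8 * H 1 + 9 / 16 * H 2"
      have "24 * poly (hstar_poly d h) z = of_real A * u\<^sup>2 + of_real B * u + of_real C"
        using Hsym[of 0] Hsym[of 1] unfolding z \<open>d = 4\<close> u_def A_def B_def C_def
        by (simp add: poly_hstar_poly eval_nat_numeral hH H0 field_simps)
      then have eq: "of_real A * u\<^sup>2 + of_real B * u + of_real C = 0"
        using root by simp
      have pos: "4 * A * (3 / 2)\<^sup>2 + B \<ge> 0"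
        using H[of 1] H[of 2] unfolding A_def B_def by (simp add: power2_eq_square field_simps)
      have "4 * A * C \<le> (4 * A * (3 / 2)\<^sup>2 + B)\<^sup>2"
        using H[of 1] H[of 2] unfolding A_def B_def C_def
        by (simp add: power2_eq_square algebra_simps)
      then have "\<bar>x\<bar> \<le> 3 / 2"
        using H[of 1] H[of 2] that pos
        by (intro quadratic_nonreal_root_bound[OF _ eq u_def]) (auto simp: A_def)
      then show ?thesis
        using \<open>d = 4\<close> by simp
    next
      case 5
      define A B C where "A = 1 + H 1 + H 2" and "B = 115 / 2 + 35 / 2 * H 1 - 5 / 2 * H 2"
        and "C = 1689 / 16 - 71 / 16 * H 1 + 9 / 16 * H 2"
      have "120 * poly (hstar_poly d h) z =
          2 * Complex x y * (of_real A * u\<^sup>2 + of_real B * u + of_real C)"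
        using Hsym[of 0] Hsym[of 1] Hsym[of 2] unfolding z \<open>d = 5\<close> u_def A_def B_def C_def
        by (simp add: poly_hstar_poly eval_nat_numeral hH H0 field_simps)
      then have eq: "of_real A * u\<^sup>2 + of_real B * u + of_real C = 0"
        using root \<open>Complex x y \<noteq> 0\<close> by simp
      have pos: "4 * A * 2\<^sup>2 + B \<ge> 0"
        using H[of 1] H[of 2] unfolding A_def B_def by (simp add: power2_eq_square field_simps)
      \<comment> \<open>Expanded, the difference has only nonnegative coefficients in
        \<open>H 1\<close> and \<open>H 2\<close>.\<close>
      have "(4 * A * 2\<^sup>2 + B)\<^sup>2 - 4 * A * C =
          4980 + 4520 * H 1 + 1560 * H 2 + 1140 * (H 1)\<^sup>2 + 920 * (H 1 * H 2) + 180 * (H 2)\<^sup>2"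
        unfolding A_def B_def C_def by (simp add: power2_eq_square field_simps)
      also have "\<dots> \<ge> 0"
        using H[of 1] H[of 2] by simp
      finally have "4 * A * C \<le> (4 * A * 2\<^sup>2 + B)\<^sup>2"
        by simp
      then have "\<bar>x\<bar> \<le> 2"
        using H[of 1] H[of 2] that pos
        by (intro quadratic_nonreal_root_bound[OF _ eq u_def]) (auto simp: A_def)
      then show ?thesis
        using \<open>d = 5\<close> by simp
    qed
  qed
  moreover have "\<bar>x\<bar> \<le> (real d - 1) / 2" if "y = 0"
  proof -
    have "z = complex_of_real (Re z)"
      using that by (simp add: y_def complex_eq_iff)
    then have "poly (hstar_poly d h) (Re z) = 0"
      using root poly_hstar_poly_of_real[of d h "Re z"] by (metis of_real_eq_0_iff)
    then show ?thesis
      using hstar_poly_real_root_bounds[of d h "Re z"] sym h0 unfolding x_def by (auto simp: abs_if)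
  qed
  ultimately have "\<bar>x\<bar> \<le> (real d - 1) / 2"
    using h0 by (cases "x = 0"; cases "y = 0") auto
  then show "- (real d / 2) \<le> Re z" "Re z \<le> real d / 2 - 1"
    unfolding x_def by (auto simp: abs_le_iff field_simps)
qed

section \<open>Triangulating by a generic linear program\<close>

text \<open>With a basis minus one element as \<open>S\<close>, it says that no coordinate of
  \<open>x\<close> vanishes; with the tight vectors of a linear program as \<open>S\<close>, that
  they span.\<close>

definition generic :: "'a::real_vector set \<Rightarrow> 'a \<Rightarrow> bool" where
  "generic V x \<longleftrightarrow> (\<forall>S\<subseteq>V. x \<in> span S \<longrightarrow> span S = UNIV)"

lemma genericD: "generic V x \<Longrightarrow> S \<subseteq> V \<Longrightarrow> x \<in> span S \<Longrightarrow> span S = UNIV"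
  by (simp add: generic_def)

text \<open>Half-space form of the condition that the nonnegative combinations of \<open>V\<close>
  fill the space; boundedness of the dual polytope yields it directly.\<close>

definition positively_spanning :: "'a::real_inner set \<Rightarrow> bool" where
  "positively_spanning V \<longleftrightarrow> (\<forall>a. a \<noteq> 0 \<longrightarrow> (\<exists>v\<in>V. a \<bullet> v > 0))"

lemma generic_uminus: "generic V (- x) \<longleftrightarrow> generic V x"
  by (metis add.inverse_inverse generic_def span_neg)

text \<open>Proper subspaces are negligible, so the finitely many spanned by subsets of
  \<open>V\<close> do not cover the space.\<close>

lemma ex_generic:
  fixes V :: "'a::euclidean_space set"
  assumes "finite V"
  shows "\<exists>q. generic V q"
proof -
  have "negligible (\<Union> (span ` {S. S \<subseteq> V \<and> span S \<noteq> UNIV}))"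
  proof (intro negligible_Union)
    fix T assume "T \<in> span ` {S. S \<subseteq> V \<and> span S \<noteq> UNIV}"
    then obtain S where "T = span S" "span S \<noteq> UNIV"
      by auto
    then have "dim T \<noteq> DIM('a)"
      using dim_eq_full[of S] by simp
    then have "dim T < DIM('a)"
      using dim_subset_UNIV[of T] by linarith
    then show "negligible T"
      by (rule negligible_lowdim)
  qed (use assms in auto)
  then have "\<Union> (span ` {S. S \<subseteq> V \<and> span S \<noteq> UNIV}) \<noteq> UNIV"
    using non_negligible_UNIV by metis
  then show ?thesis
    unfolding generic_def by blast
qed

text \<open>Since \<open>q\<close> lies in no proper \<open>span S\<close>, the line through
  \<open>x\<close> in direction \<open>q\<close> meets each such subspace at most once.\<close>

lemma eventually_generic:
  fixes V :: "'a::real_vector set"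
  assumes "finite V" "generic V q"
  shows "eventually (\<lambda>\<epsilon>. generic V (x + \<epsilon> *\<^sub>R q)) (at_right 0)"
proof -
  have "eventually (\<lambda>\<epsilon>. x + \<epsilon> *\<^sub>R q \<in> span S \<longrightarrow> span S = UNIV) (at_right 0)" if "S \<subseteq> V" for S
  proof (cases "span S = UNIV \<or> (\<forall>\<epsilon>. x + \<epsilon> *\<^sub>R q \<notin> span S)")
    case False
    then obtain e where e: "x + e *\<^sub>R q \<in> span S" and "span S \<noteq> UNIV"
      by auto
    then have "q \<notin> span S"
      using genericD[OF assms(2) that] by blast
    have "\<epsilon> = e" if "x + \<epsilon> *\<^sub>R q \<in> span S" for \<epsilon>
    proof (rule ccontr)
      assume "\<epsilon> \<noteq> e"
      have "(x + \<epsilon> *\<^sub>R q) - (x + e *\<^sub>R q) \<in> span S"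
        using that e by (rule span_diff)
      then have "(\<epsilon> - e) *\<^sub>R q \<in> span S"
        by (simp add: algebra_simps)
      then show False
        using \<open>q \<notin> span S\<close> \<open>\<epsilon> \<noteq> e\<close> using span_scale[of "(\<epsilon> - e) *\<^sub>R q" S "1 / (\<epsilon> - e)"] by simp
    qed
    moreover have "eventually (\<lambda>\<epsilon>. \<epsilon> \<noteq> e) (at_right 0)"
      by (rule eventually_neq_at_within)
    ultimately show ?thesis
      by (metis (mono_tags, lifting) eventually_mono)
  qed auto
  then have "eventually (\<lambda>\<epsilon>. \<forall>S\<in>Pow V. x + \<epsilon> *\<^sub>R q \<in> span S \<longrightarrow> span S = UNIV) (at_right 0)"
    using assms by (intro eventually_ball_finite) auto
  then show ?thesis
    by (simp add: generic_def Pow_def)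
qed

section \<open>Coordinates with respect to a basis\<close>

context
  fixes B :: "'a::euclidean_space set"
  assumes ind: "independent B" and sp: "span B = UNIV"
begin

lemma basis_finite: "finite B"
  using ind by (rule independent_imp_finite)

lemma card_basis: "card B = DIM('a)"
proof -
  have "card B = dim B"
    using ind by (rule dim_eq_card_independent[symmetric])
  also have "\<dots> = dim (span B)"
    by (rule dim_span[symmetric])
  finally show ?thesis
    by (simp only: sp dim_UNIV)
qed

lemma sum_representation: "(\<Sum>b\<in>B. representation B x b *\<^sub>R b) = x"
  by (rule sum_representation_eq[OF ind]) (auto simp: sp basis_finite)

lemma linear_coordinate: "linear (\<lambda>x. representation B x b)"
  by (rule linearI) (auto simp: representation_add[OF ind] representation_scale[OF ind] sp)

lemma representation_sum_scale:
  assumes "b \<in> B"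
  shows "representation B (\<Sum>v\<in>B. f v *\<^sub>R v) b = f b"
proof -
  have "representation B (\<Sum>v\<in>B. f v *\<^sub>R v) b = (\<Sum>v\<in>B. f v * representation B v b)"
    by (simp add: linear_sum[OF linear_coordinate] linear_scale[OF linear_coordinate])
  also have "\<dots> = (\<Sum>v\<in>B. if v = b then f v else 0)"
    by (intro sum.cong) (auto simp: representation_basis[OF ind])
  finally show ?thesis
    using assms basis_finite by simp
qed

lemma ex_inner_eq_sum_representation:
  obtains y where "\<And>x. y \<bullet> x = (\<Sum>b\<in>B. representation B x b * c b)"
proof
  have "linear (\<lambda>x. \<Sum>b\<in>B. representation B x b * c b)"
    using linear_add[OF linear_coordinate] linear_scale[OF linear_coordinate]
    by (intro linearI) (simp_all add: distrib_right sum.distrib sum_distrib_left mult.assoc)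
  \<comment> \<open>Riesz representation: the adjoint of a real functional, evaluated at
    \<open>1\<close>, is the vector representing it.\<close>
  then show "adjoint (\<lambda>x. \<Sum>b\<in>B. representation B x b * c b) 1 \<bullet> x = (\<Sum>b\<in>B. representation B x b * c b)" for x
    using adjoint_works[of "\<lambda>x. \<Sum>b\<in>B. representation B x b * c b" x 1]
    by (simp add: inner_commute)
qed

end

lemma generic_representation_nonzero:
  fixes B :: "'a::euclidean_space set"
  assumes B: "independent B" "span B = UNIV" "B \<subseteq> V" and "generic V x" "b \<in> B"
  shows "representation B x b \<noteq> 0"
proof
  assume "representation B x b = 0"
  have "x = (\<Sum>v\<in>B. representation B x v *\<^sub>R v)"
    by (rule sum_representation[OF B(1,2), symmetric])
  also have "\<dots> = (\<Sum>v\<in>B - {b}. representation B x v *\<^sub>R v)"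
    using \<open>representation B x b = 0\<close> basis_finite[OF B(1,2)]
    by (intro sum.mono_neutral_right) auto
  also have "\<dots> \<in> span (B - {b})"
    by (intro span_sum span_scale span_base)
  finally have "span (B - {b}) = UNIV"
    using B(3) by (intro genericD[OF \<open>generic V x\<close>]) auto
  then show False
    using B \<open>b \<in> B\<close> unfolding dependent_def by blast
qed

text \<open>Otherwise a closed half-space with the origin on its boundary contains the hull: by
  separation, or, if the hull has empty interior, because it lies in a hyperplane. The inner normal,
  negated, contradicts positive spanning.\<close>

lemma positively_spanning_imp_interior:
  fixes V :: "'a::euclidean_space set"
  assumes "positively_spanning V"
  shows "0 \<in> interior (convex hull V)"
proof (rule ccontr)
  let ?P = "convex hull V"
  assume not: "0 \<notin> interior ?P"
  have no_halfspace: False if "a \<noteq> 0" "\<And>x. x \<in> ?P \<Longrightarrow> a \<bullet> x \<ge> 0" for a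
  proof -
    obtain v where "v \<in> V" "- a \<bullet> v > 0"
      using assms \<open>a \<noteq> 0\<close> unfolding positively_spanning_def by (metis neg_equal_0_iff_equal)
    then show False
      using that(2)[of v] hull_inc[of v V convex] by simp
  qed
  show False
  proof (cases "interior ?P = {}")
    case True
    then obtain a b where "a \<noteq> 0" "?P \<subseteq> {x. a \<bullet> x = b}"
      using empty_interior_subset_hyperplane[of ?P] by auto
    then show False
      using no_halfspace[of a] no_halfspace[of "- a"] by (cases "b \<ge> 0") force+
  next
    case False
    obtain a where "a \<noteq> 0" and a: "\<forall>x\<in>interior ?P. 0 \<le> a \<bullet> x"
      using separating_hyperplane_set_0[of "interior ?P"] not convex_interior[of ?P] by auto
    have "closure (interior ?P) \<subseteq> {x. a \<bullet> x \<ge> 0}"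
      using a by (intro closure_minimal closed_halfspace_ge) auto
    moreover have "?P \<subseteq> closure (interior ?P)"
      using convex_closure_interior[OF _ False] closure_subset[of ?P] by simp
    ultimately show False
      using no_halfspace[OF \<open>a \<noteq> 0\<close>] by auto
  qed
qed

text \<open>A perturbation of the costs that are all \<open>1\<close>. Reduced costs never vanish,
  which excludes ties, and a positive one still certifies that \<open>v\<close> has height at most
  \<open>1\<close> with respect to \<open>B\<close>.\<close>

definition generic_costs :: "'a::euclidean_space set \<Rightarrow> ('a \<Rightarrow> real) \<Rightarrow> bool" where
  "generic_costs V c \<longleftrightarrow> (\<forall>v\<in>V. c v > 0) \<and>
     (\<forall>B\<subseteq>V. independent B \<longrightarrow> span B = UNIV \<longrightarrow>
        (\<forall>v\<in>V - B. (\<Sum>b\<in>B. representation B v b * c b) \<noteq> c v \<and>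
          ((\<Sum>b\<in>B. representation B v b * c b) < c v \<longrightarrow> (\<Sum>b\<in>B. representation B v b) \<le> 1)))"

lemma generic_costsD:
  assumes "generic_costs V c" "B \<subseteq> V" "independent B" "span B = UNIV" "v \<in> V - B"
  shows "(\<Sum>b\<in>B. representation B v b * c b) \<noteq> c v"
    and "(\<Sum>b\<in>B. representation B v b * c b) < c v \<Longrightarrow> (\<Sum>b\<in>B. representation B v b) \<le> 1"
  using assms by (simp_all add: generic_costs_def)

text \<open>A reduced cost is a polynomial in the perturbation parameter. Distinct exponents make it
  nonzero, and its value at \<open>0\<close> is the unperturbed reduced cost, so both requirements
  hold for all small positive parameters.\<close>

lemma ex_generic_costs:
  fixes V :: "'a::euclidean_space set"
  assumes "finite V"
  shows "\<exists>c. generic_costs V c"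
proof -
  obtain e :: "'a \<Rightarrow> nat" where inj: "inj_on e V"
    using finite_imp_inj_to_nat_seg[OF assms] by blast
  \<comment> \<open>\<open>Suc\<close> keeps the exponents positive even where
    \<open>e v = 0\<close>, so all costs tend to \<open>1\<close>.\<close>
  define c where "c \<epsilon> v = 1 + \<epsilon> ^ Suc (e v)" for \<epsilon> :: real and v
  have ev: "eventually (\<lambda>\<epsilon>. (\<Sum>b\<in>B. r b * c \<epsilon> b) \<noteq> c \<epsilon> v \<and>
      ((\<Sum>b\<in>B. r b * c \<epsilon> b) < c \<epsilon> v \<longrightarrow> (\<Sum>b\<in>B. r b) \<le> 1)) (at_right 0)"
    if "B \<subseteq> V" "v \<in> V - B" for B v and r :: "'a \<Rightarrow> real"
  proof -
    define p where "p = monom 1 (Suc (e v)) - (\<Sum>b\<in>B. monom (r b) (Suc (e b))) + [:1 - (\<Sum>b\<in>B. r b):]"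
    have p: "poly p \<epsilon> = c \<epsilon> v - (\<Sum>b\<in>B. r b * c \<epsilon> b)" for \<epsilon>
      by (simp add: p_def c_def poly_sum poly_monom distrib_left sum.distrib)
    have "e b \<noteq> e v" if "b \<in> B" for b
      using inj \<open>B \<subseteq> V\<close> \<open>v \<in> V - B\<close> that by (auto simp: inj_on_def)
    then have "coeff p (Suc (e v)) = 1"
      by (simp add: p_def coeff_sum)
    then have "p \<noteq> 0"
      by auto
    then have "eventually (\<lambda>\<epsilon>. \<forall>t\<in>{t. poly p t = 0}. \<epsilon> \<noteq> t) (at_right 0)"
      by (intro eventually_ball_finite poly_roots_finite ballI eventually_neq_at_within)
    then have "eventually (\<lambda>\<epsilon>. poly p \<epsilon> \<noteq> 0) (at_right 0)"
      by (rule eventually_mono) auto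
    moreover have "eventually (\<lambda>\<epsilon>. poly p \<epsilon> > 0 \<longrightarrow> (\<Sum>b\<in>B. r b) \<le> 1) (at_right 0)"
    proof (cases "(\<Sum>b\<in>B. r b) \<le> 1")
      case False
      then have "poly p 0 < 0"
        by (simp add: p c_def)
      moreover have "(poly p \<longlongrightarrow> poly p 0) (at_right 0)"
        by (intro tendsto_intros)
      ultimately have "eventually (\<lambda>\<epsilon>. poly p \<epsilon> < 0) (at_right 0)"
        using order_tendstoD(2) by blast
      then show ?thesis
        by (rule eventually_mono) auto
    qed simp
    ultimately show ?thesis
      by eventually_elim (auto simp: p)
  qed
  define Q where "Q \<epsilon> B v \<longleftrightarrow> (\<Sum>b\<in>B. representation B v b * c \<epsilon> b) \<noteq> c \<epsilon> v \<and>
      ((\<Sum>b\<in>B. representation B v b * c \<epsilon> b) < c \<epsilon> v \<longrightarrow> (\<Sum>b\<in>B. representation B v b) \<le> 1)" for \<epsilon> B v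
  have "eventually (\<lambda>\<epsilon>. \<forall>B\<in>Pow V. \<forall>v\<in>V - B. Q \<epsilon> B v) (at_right 0)"
    using assms unfolding Q_def by (intro eventually_ball_finite ballI ev) auto
  moreover have "eventually (\<lambda>\<epsilon>::real. \<epsilon> > 0) (at_right 0)"
    by (rule eventually_at_right_less)
  ultimately have "eventually (\<lambda>\<epsilon>. (\<forall>B\<in>Pow V. \<forall>v\<in>V - B. Q \<epsilon> B v) \<and> \<epsilon> > 0) (at_right 0)"
    by (rule eventually_conj)
  then obtain \<epsilon> where \<epsilon>: "\<forall>B\<in>Pow V. \<forall>v\<in>V - B. Q \<epsilon> B v" "\<epsilon> > 0"
    using eventually_happens' trivial_limit_at_right_real by (metis (no_types, lifting))
  have "c \<epsilon> v > 0" for v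
    using \<epsilon>(2) by (simp add: c_def add_pos_pos)
  then show ?thesis
    using \<epsilon>(1) unfolding Q_def generic_costs_def by blast
qed

text \<open>
  The optimal bases of the linear program that minimises \<open>\<Sum>v\<in>V. \<lambda> v * c v\<close> subject to
  \<open>(\<Sum>v\<in>V. \<lambda> v *\<^sub>R v) = x\<close> and \<open>\<lambda> \<ge> 0\<close>: dual feasibility does not depend on \<open>x\<close>.
\<close>

definition optimal_bases :: "'a::euclidean_space set \<Rightarrow> ('a \<Rightarrow> real) \<Rightarrow> 'a set set" where
  "optimal_bases V c = {B. B \<subseteq> V \<and> independent B \<and> span B = UNIV \<and>
     (\<forall>v\<in>V - B. (\<Sum>b\<in>B. representation B v b * c b) < c v)}"

lemma optimal_basesD:
  assumes "B \<in> optimal_bases V c"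
  shows "independent B" "span B = UNIV" "B \<subseteq> V"
    and "\<And>v. v \<in> V - B \<Longrightarrow> (\<Sum>b\<in>B. representation B v b * c b) < c v"
  using assms by (simp_all add: optimal_bases_def)

lemma optimal_bases_subset: "optimal_bases V c \<subseteq> Pow V"
  using optimal_basesD(3) by blast

text \<open>Weak duality: the vector \<open>y\<close> with values \<open>c b\<close> on
  \<open>B\<close> satisfies \<open>y \<bullet> v \<le> c v\<close> on \<open>V\<close>, strictly
  off \<open>B\<close>. It is evaluated on the expansion of \<open>x\<close> in
  \<open>B'\<close>.\<close>

lemma optimal_basis_cost_le:
  assumes B: "B \<in> optimal_bases V c"
    and B': "B' \<subseteq> V" "independent B'" "span B' = UNIV" and x: "\<And>b. b \<in> B' \<Longrightarrow> representation B' x b > 0"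
  shows "(\<Sum>b\<in>B. representation B x b * c b) \<le> (\<Sum>b\<in>B'. representation B' x b * c b)"
    and "\<not> B' \<subseteq> B \<Longrightarrow>
      (\<Sum>b\<in>B. representation B x b * c b) < (\<Sum>b\<in>B'. representation B' x b * c b)"
proof -
  have ind: "independent B" "span B = UNIV"
    using B by (auto simp: optimal_bases_def)
  obtain y where y: "\<And>x. y \<bullet> x = (\<Sum>b\<in>B. representation B x b * c b)"
    using ex_inner_eq_sum_representation[OF ind] by blast
  have "y \<bullet> b = c b" if "b \<in> B" for b
  proof -
    have "y \<bullet> b = (\<Sum>a\<in>B. if b = a then c a else 0)"
      unfolding y using that by (intro sum.cong) (auto simp: representation_basis[OF ind(1)])
    then show ?thesis
      using that basis_finite[OF ind] by simp
  qed
  moreover have less: "y \<bullet> v < c v" if "v \<in> V - B" for v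
    using B that by (auto simp: optimal_bases_def y)
  ultimately have le: "y \<bullet> v \<le> c v" if "v \<in> V" for v
    using that by (cases "v \<in> B") (auto intro: less_imp_le)
  have eq: "y \<bullet> x = (\<Sum>b\<in>B'. representation B' x b * (y \<bullet> b))"
    by (subst sum_representation[OF B'(2,3), of x, symmetric]) (simp add: inner_sum_right)
  show "(\<Sum>b\<in>B. representation B x b * c b) \<le> (\<Sum>b\<in>B'. representation B' x b * c b)"
    unfolding y[symmetric] eq using x le B' by (intro sum_mono mult_left_mono) (auto intro: less_imp_le)
  assume "\<not> B' \<subseteq> B"
  then obtain b where b: "b \<in> B'" "b \<notin> B"
    by auto
  then have "representation B' x b * (y \<bullet> b) < representation B' x b * c b"
    using x less[of b] B' by (intro mult_strict_left_mono) auto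
  then show "(\<Sum>b\<in>B. representation B x b * c b) < (\<Sum>b\<in>B'. representation B' x b * c b)"
    unfolding y[symmetric] eq using x le b B' basis_finite[OF B'(2,3)]
    by (intro sum_strict_mono_ex1) (auto intro!: mult_left_mono intro: less_imp_le)
qed

text \<open>Of two different bases, each would cost at most as much as the other, strictly less in
  one direction.\<close>

lemma optimal_basis_unique:
  assumes "B \<in> optimal_bases V c" "B' \<in> optimal_bases V c"
    and "\<And>b. b \<in> B \<Longrightarrow> representation B x b > 0" "\<And>b. b \<in> B' \<Longrightarrow> representation B' x b > 0"
  shows "B = B'"
proof (rule ccontr)
  assume "B \<noteq> B'"
  then consider "\<not> B \<subseteq> B'" | "\<not> B' \<subseteq> B"
    by auto
  then show False
    using optimal_basis_cost_le[of B V c B' x] optimal_basis_cost_le[of B' V c B x] assms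
    unfolding optimal_bases_def by cases force+
qed

text \<open>The ray through \<open>x\<close> leaves the hull of the rescaled vectors at a boundary
  point, and a supporting hyperplane there is a dual solution \<open>y\<close>. The tight vectors
  span because \<open>x\<close> is generic, and form a basis because the costs are.\<close>

lemma ex_optimal_basis:
  fixes V :: "'a::euclidean_space set"
  assumes V: "finite V" "positively_spanning V" and c: "generic_costs V c" and x: "generic V x"
  shows "\<exists>B\<in>optimal_bases V c. \<forall>b\<in>B. representation B x b > 0"
proof -
  define W where "W = (\<lambda>v. v /\<^sub>R c v) ` V"
  have cpos: "c v > 0" if "v \<in> V" for v
    using c that by (auto simp: generic_costs_def)
  have "positively_spanning W"
    unfolding positively_spanning_def
  proof (intro allI impI)
    fix a :: 'a assume "a \<noteq> 0"
    then obtain v where "v \<in> V" "a \<bullet> v > 0"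
      using V(2) by (auto simp: positively_spanning_def)
    then show "\<exists>w\<in>W. a \<bullet> w > 0"
      using cpos by (intro bexI[of _ "v /\<^sub>R c v"]) (auto simp: W_def)
  qed
  then have int: "0 \<in> interior (convex hull W)"
    by (rule positively_spanning_imp_interior)
  have "x \<noteq> 0"
  proof
    assume "x = 0"
    then have "span {} = (UNIV :: 'a set)"
      using genericD[OF x, of "{}"] by simp
    then have "dim (UNIV :: 'a set) = dim ({} :: 'a set)"
      by (metis dim_span)
    then show False
      by simp
  qed
  have "finite W"
    using V by (simp add: W_def)
  then have cpt: "compact (convex hull W)"
    by (rule finite_imp_compact_convex_hull)
  obtain t where t: "t > 0" "0 + t *\<^sub>R x \<in> frontier (convex hull W)"
    using ray_to_frontier[OF compact_imp_bounded[OF cpt] int \<open>x \<noteq> 0\<close>] by blast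
  then have tx: "t *\<^sub>R x \<in> convex hull W" "t *\<^sub>R x \<notin> interior (convex hull W)"
    using compact_imp_closed[OF cpt] by (auto simp: frontier_def)
  have rel: "rel_interior (convex hull W) = interior (convex hull W)"
    using int by (intro rel_interior_interior affine_hull_nonempty_interior) auto
  obtain a where "a \<noteq> 0" and a: "\<And>y. y \<in> convex hull W \<Longrightarrow> a \<bullet> (t *\<^sub>R x) \<le> a \<bullet> y"
    and "a \<bullet> (t *\<^sub>R x) < a \<bullet> 0"
    using supporting_hyperplane_rel_boundary[OF convex_convex_hull tx(1)] tx(2) rel int by metis
  \<comment> \<open>The divisor is negative, so the supporting inequality reverses into
    \<open>y \<bullet> w \<le> 1\<close> on the hull, with equality at the exit point.\<close>
  define y where "y = a /\<^sub>R (a \<bullet> (t *\<^sub>R x))"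
  have neg: "a \<bullet> (t *\<^sub>R x) < 0"
    using \<open>a \<bullet> (t *\<^sub>R x) < a \<bullet> 0\<close> by simp
  have ytx: "y \<bullet> (t *\<^sub>R x) = 1"
    unfolding y_def inner_scaleR_left by (intro left_inverse less_imp_neq neg)
  have y: "y \<bullet> w \<le> 1" if "w \<in> convex hull W" for w
    using a[OF that] neg by (simp add: y_def divide_simps mult.commute)
  have yv: "y \<bullet> v \<le> c v" if "v \<in> V" for v
    using y[of "v /\<^sub>R c v"] hull_inc[of "v /\<^sub>R c v" W convex] that cpos[OF that] by (simp add: W_def field_simps)
  obtain u where u: "\<And>w. w \<in> W \<Longrightarrow> u w \<ge> 0" "sum u W = 1" "(\<Sum>w\<in>W. u w *\<^sub>R w) = t *\<^sub>R x"
    using tx(1) unfolding convex_hull_finite[OF \<open>finite W\<close>] by auto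
  \<comment> \<open>Complementary slackness: a convex combination of values at most \<open>1\<close>
    equals \<open>1\<close>, so each value with nonzero weight is \<open>1\<close>.\<close>
  have tight: "y \<bullet> w = 1" if "w \<in> W" "u w \<noteq> 0" for w
  proof -
    have "(\<Sum>w\<in>W. u w * (1 - y \<bullet> w)) = sum u W - y \<bullet> (\<Sum>w\<in>W. u w *\<^sub>R w)"
      by (simp add: inner_sum_right right_diff_distrib sum_subtractf)
    also have "\<dots> = 0"
      using u ytx by simp
    finally have "\<forall>w\<in>W. u w * (1 - y \<bullet> w) = 0"
      using u y hull_inc[of _ W convex] \<open>finite W\<close> by (subst (asm) sum_nonneg_eq_0_iff) auto
    then show ?thesis
      using that by auto
  qed
  define S where "S = {v \<in> V. y \<bullet> v = c v}"
  have "t *\<^sub>R x \<in> span S"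
    unfolding u(3)[symmetric]
  proof (rule span_sum)
    fix w assume "w \<in> W"
    then obtain v where v: "v \<in> V" "w = v /\<^sub>R c v"
      by (auto simp: W_def)
    show "u w *\<^sub>R w \<in> span S"
    proof (cases "u w = 0")
      case False
      then have "v \<in> S"
        using tight[OF \<open>w \<in> W\<close>] v cpos[OF v(1)] by (auto simp: S_def field_simps)
      then show ?thesis
        using v by (auto intro: span_scale span_base)
    qed (simp add: span_zero)
  qed
  then have "x \<in> span S"
    using span_scale[of "t *\<^sub>R x" S "1 / t"] t by simp
  then have "span S = UNIV"
    by (intro genericD[OF x]) (auto simp: S_def)
  obtain B where B: "B \<subseteq> S" "independent B" "S \<subseteq> span B"
    using maximal_independent_subset by blast
  have spB: "span B = UNIV"
    using span_minimal[OF B(3) subspace_span] \<open>span S = UNIV\<close> by auto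
  have BV: "B \<subseteq> V"
    using B by (auto simp: S_def)
  have cost: "(\<Sum>b\<in>B. representation B v b * c b) = y \<bullet> v" for v
  proof -
    have "y \<bullet> v = (\<Sum>b\<in>B. representation B v b * (y \<bullet> b))"
      by (subst sum_representation[OF B(2) spB, of v, symmetric]) (simp add: inner_sum_right)
    also have "\<dots> = (\<Sum>b\<in>B. representation B v b * c b)"
      using B(1) by (intro sum.cong) (auto simp: S_def)
    finally show ?thesis ..
  qed
  have less: "y \<bullet> v < c v" if "v \<in> V - B" for v
    using generic_costsD(1)[OF c BV B(2) spB that] yv[of v] that unfolding cost by simp
  then have "S \<subseteq> B"
    unfolding S_def by fastforce
  then have "S = B"
    using B(1) by blast
  have "B \<in> optimal_bases V c"
    using BV B(2) spB less by (simp add: optimal_bases_def cost)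
  \<comment> \<open>The exit point is a nonnegative combination of multiples of tight vectors, which
    gives nonnegative coordinates; genericity of \<open>x\<close> excludes zero.\<close>
  moreover have "representation B x b > 0" if "b \<in> B" for b
  proof -
    have "t * representation B x b = representation B (\<Sum>w\<in>W. u w *\<^sub>R w) b"
      using u(3) linear_scale[OF linear_coordinate[OF B(2) spB]] by simp
    also have "\<dots> = (\<Sum>w\<in>W. u w * representation B w b)"
      by (simp add: linear_sum[OF linear_coordinate[OF B(2) spB]] linear_scale[OF linear_coordinate[OF B(2) spB]])
    also have "\<dots> \<ge> 0"
    proof (rule sum_nonneg)
      fix w assume "w \<in> W"
      then obtain v where v: "v \<in> V" "w = v /\<^sub>R c v"
        by (auto simp: W_def)
      show "u w * representation B w b \<ge> 0"
      proof (cases "u w = 0")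
        case False
        then have "v \<in> B"
          using tight[OF \<open>w \<in> W\<close>] v cpos[OF v(1)] by (simp add: S_def field_simps flip: \<open>S = B\<close>)
        then have "representation B w b \<ge> 0"
          using v cpos[OF v(1)] by (simp add: linear_scale[OF linear_coordinate[OF B(2) spB]] representation_basis[OF B(2)])
        then show ?thesis
          using u(1)[OF \<open>w \<in> W\<close>] by simp
      qed simp
    qed
    finally have "representation B x b \<ge> 0"
      using t by (simp add: zero_le_mult_iff)
    then show ?thesis
      using generic_representation_nonzero[OF B(2) spB BV x that] by linarith
  qed
  ultimately show ?thesis
    by blast
qed

section \<open>Half-open cones\<close>

text \<open>Stars and bars with slack: fixing the value \<open>i\<close> at the new element leaves
  the bound \<open>k - i\<close>, and summing over \<open>i\<close> is the hockey-stick
  identity.\<close>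

lemma card_bounded_compositions:
  assumes "finite B"
  shows "finite {n :: 'a \<Rightarrow> nat. (\<forall>b. b \<notin> B \<longrightarrow> n b = 0) \<and> sum n B \<le> k} \<and>
    card {n :: 'a \<Rightarrow> nat. (\<forall>b. b \<notin> B \<longrightarrow> n b = 0) \<and> sum n B \<le> k} = (k + card B) choose card B"
  using assms
proof (induction B arbitrary: k rule: finite_induct)
  case empty
  have "{n :: 'a \<Rightarrow> nat. \<forall>b. n b = 0} = {\<lambda>_. 0}"
    by auto
  then show ?case
    by simp
next
  case (insert a B)
  let ?S = "\<lambda>B k. {n :: 'a \<Rightarrow> nat. (\<forall>b. b \<notin> B \<longrightarrow> n b = 0) \<and> sum n B \<le> k}"
  have sum_upd: "(\<Sum>x\<in>B. if x = a then t else n x) = sum n B" for n :: "'a \<Rightarrow> nat" and t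
    using insert.hyps by (intro sum.cong) auto
  have "bij_betw (\<lambda>(i, n). n(a := i)) (SIGMA i:{..k}. ?S B (k - i)) (?S (insert a B) k)"
    using insert.hyps
    by (intro bij_betw_byWitness[where f' = "\<lambda>n. (n a, n(a := 0))"]) (auto simp: sum_upd)
  note bij = this
  have fin: "finite (SIGMA i:{..k}. ?S B (k - i))"
    using insert.IH by blast
  have "card (?S (insert a B) k) = card (SIGMA i:{..k}. ?S B (k - i))"
    and "finite (?S (insert a B) k)"
    using bij_betw_same_card[OF bij] bij_betw_finite[OF bij] fin by simp_all
  moreover have "card (SIGMA i:{..k}. ?S B (k - i)) = (\<Sum>i\<le>k. (k - i + card B) choose card B)"
    using insert.IH by (subst card_SigmaI) auto
  moreover have "\<dots> = (\<Sum>i\<le>k. (card B + i) choose card B)"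
    using sum.nat_diff_reindex[of "\<lambda>i. (card B + i) choose card B" "Suc k"]
    by (simp add: lessThan_Suc_atMost add.commute)
  moreover have "\<dots> = (k + card (insert a B)) choose card (insert a B)"
    using insert.hyps choose_rising_sum(1)[of "card B" k] by (simp add: add.commute)
  ultimately show ?case
    by simp
qed

definition half_open_cone :: "'a::euclidean_space set \<Rightarrow> 'a \<Rightarrow> 'a set" where
  "half_open_cone B q = {x. \<forall>b\<in>B. representation B x b > 0 \<or>
     representation B x b = 0 \<and> representation B q b > 0}"

text \<open>The fundamental parallelepiped of \<open>B\<close> with one of each two opposite facets
  removed, matching the walls that \<open>half_open_cone\<close> keeps.\<close>

definition half_open_box :: "'a::euclidean_space set \<Rightarrow> 'a \<Rightarrow> 'a set" where
  "half_open_box B q = {x. \<forall>b\<in>B. if representation B q b > 0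
     then 0 \<le> representation B x b \<and> representation B x b < 1
     else 0 < representation B x b \<and> representation B x b \<le> 1}"

text \<open>
  A point \<open>x\<close> belongs to the half-open cone iff \<open>x + \<epsilon> q\<close> is interior to the cone for all
  small \<open>\<epsilon> > 0\<close>; by genericity there is exactly one cone of which it is.
\<close>

lemma ex1_half_open_cone:
  fixes V :: "'a::euclidean_space set"
  assumes V: "finite V" "positively_spanning V" and c: "generic_costs V c" and q: "generic V q"
  shows "\<exists>!B. B \<in> optimal_bases V c \<and> x \<in> half_open_cone B q"
proof -
  have "finite (optimal_bases V c)"
    using V(1) finite_subset[OF optimal_bases_subset] by blast
  have sgn: "eventually (\<lambda>\<epsilon>. representation B (x + \<epsilon> *\<^sub>R q) b > 0 \<longleftrightarrow>
      representation B x b > 0 \<or> representation B x b = 0 \<and> representation B q b > 0) (at_right 0)"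
    if "B \<in> optimal_bases V c" "b \<in> B" for B b
  proof -
    note B = optimal_basesD[OF that(1)]
    define s t where "s = representation B x b" and "t = representation B q b"
    have eq: "representation B (x + \<epsilon> *\<^sub>R q) b = s + \<epsilon> * t" for \<epsilon>
      using linear_add[OF linear_coordinate[OF B(1,2)]] linear_scale[OF linear_coordinate[OF B(1,2)]]
      by (simp add: s_def t_def)
    have lim: "((\<lambda>\<epsilon>. s + \<epsilon> * t) \<longlongrightarrow> s + 0 * t) (at_right 0)"
      by (intro tendsto_intros)
    consider "s > 0" | "s < 0" | "s = 0"
      by linarith
    then have "eventually (\<lambda>\<epsilon>. s + \<epsilon> * t > 0 \<longleftrightarrow> s > 0 \<or> s = 0 \<and> t > 0) (at_right 0)"
    proof cases
      case 1
      then have "eventually (\<lambda>\<epsilon>. s + \<epsilon> * t > 0) (at_right 0)"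
        using order_tendstoD(1)[OF lim] by simp
      with 1 show ?thesis
        by simp
    next
      case 2
      then have "eventually (\<lambda>\<epsilon>. s + \<epsilon> * t < 0) (at_right 0)"
        using order_tendstoD(2)[OF lim] by simp
      then show ?thesis
        using 2 by (elim eventually_mono) auto
    next
      case 3
      have "eventually (\<lambda>\<epsilon>::real. \<epsilon> > 0) (at_right 0)"
        by (rule eventually_at_right_less)
      then show ?thesis
        using 3 by (elim eventually_mono) (auto simp: zero_less_mult_iff)
    qed
    then show ?thesis
      unfolding eq s_def t_def .
  qed
  have "eventually (\<lambda>\<epsilon>. \<forall>B\<in>optimal_bases V c. \<forall>b\<in>B. representation B (x + \<epsilon> *\<^sub>R q) b > 0 \<longleftrightarrow>
      representation B x b > 0 \<or> representation B x b = 0 \<and> representation B q b > 0) (at_right 0)"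
    by (intro eventually_ball_finite ballI sgn \<open>finite (optimal_bases V c)\<close>)
       (blast intro: finite_subset[OF optimal_basesD(3) V(1)])
  then have "eventually (\<lambda>\<epsilon>. (\<forall>B\<in>optimal_bases V c. \<forall>b\<in>B. representation B (x + \<epsilon> *\<^sub>R q) b > 0 \<longleftrightarrow>
      representation B x b > 0 \<or> representation B x b = 0 \<and> representation B q b > 0) \<and>
      generic V (x + \<epsilon> *\<^sub>R q)) (at_right 0)"
    using eventually_generic[OF V(1) q] by (rule eventually_conj)
  then obtain \<epsilon> where sgn: "\<And>B b. B \<in> optimal_bases V c \<Longrightarrow> b \<in> B \<Longrightarrow> representation B (x + \<epsilon> *\<^sub>R q) b > 0 \<longleftrightarrow>
      representation B x b > 0 \<or> representation B x b = 0 \<and> representation B q b > 0"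
    and gen: "generic V (x + \<epsilon> *\<^sub>R q)"
    using eventually_happens'[OF trivial_limit_at_right_real] by blast
  have "x \<in> half_open_cone B q \<longleftrightarrow> (\<forall>b\<in>B. representation B (x + \<epsilon> *\<^sub>R q) b > 0)"
    if "B \<in> optimal_bases V c" for B
    using sgn[OF that] by (auto simp: half_open_cone_def)
  then show ?thesis
    using ex_optimal_basis[OF V c gen] optimal_basis_unique[of _ V c _ "x + \<epsilon> *\<^sub>R q"] by metis
qed

text \<open>\<open>k\<close> is the floor if \<open>P\<close> holds and the ceiling minus one
  otherwise; the assumption makes it nonnegative.\<close>

lemma ex_half_open_fractional_part:
  fixes t :: real
  assumes "t > 0 \<or> t = 0 \<and> P"
  shows "\<exists>k :: nat. if P then 0 \<le> t - k \<and> t - k < 1 else 0 < t - k \<and> t - k \<le> 1"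
proof (cases P)
  case True
  then have "real (nat \<lfloor>t\<rfloor>) = of_int \<lfloor>t\<rfloor>"
    using assms by auto
  then show ?thesis
    using True by (intro exI[of _ "nat \<lfloor>t\<rfloor>"]) (simp, linarith)
next
  case False
  then have "\<lceil>t\<rceil> \<ge> 1"
    using assms by simp
  then have "real (nat (\<lceil>t\<rceil> - 1)) = of_int \<lceil>t\<rceil> - 1"
    by simp
  then show ?thesis
    using False by (intro exI[of _ "nat (\<lceil>t\<rceil> - 1)"]) (simp, linarith)
qed

text \<open>
  Rounding the coordinates writes each lattice point of the cone uniquely as a box point plus
  a sum of generators, so the count reduces to counting compositions.
\<close>

lemma card_half_open_cone:
  fixes B L :: "'a::euclidean_space set"
  assumes B: "independent B" "span B = UNIV" "B \<subseteq> L"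
    and L: "0 \<in> L" "\<And>x y. x \<in> L \<Longrightarrow> y \<in> L \<Longrightarrow> x + y \<in> L" "\<And>x. x \<in> L \<Longrightarrow> - x \<in> L"
    and fin: "finite (half_open_box B q \<inter> L)"
    and h: "\<And>p. p \<in> half_open_box B q \<inter> L \<Longrightarrow> (\<Sum>b\<in>B. representation B p b) = real (ht p)"
    and ht: "\<And>p. p \<in> half_open_box B q \<inter> L \<Longrightarrow> ht p \<le> DIM('a)"
  shows "card {x \<in> half_open_cone B q \<inter> L. (\<Sum>b\<in>B. representation B x b) \<le> real m} =
    (\<Sum>p\<in>half_open_box B q \<inter> L. (m + DIM('a) - ht p) choose DIM('a))"
proof -
  let ?rep = "representation B"
  note finB = basis_finite[OF B(1,2)]
  note lin = linear_add[OF linear_coordinate[OF B(1,2)]]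
  note cardB = card_basis[OF B(1,2)]
  \<comment> \<open>Written with a sum, because a truncated \<open>m - ht p\<close> would admit the
    zero composition for box points higher than \<open>m\<close>.\<close>
  define S where "S p = {n :: 'a \<Rightarrow> nat. (\<forall>b. b \<notin> B \<longrightarrow> n b = 0) \<and> ht p + sum n B \<le> m}" for p
  define f where "f = (\<lambda>(p, n :: 'a \<Rightarrow> nat). p + (\<Sum>b\<in>B. real (n b) *\<^sub>R b))"
  have scale: "real k *\<^sub>R b \<in> L" if "b \<in> L" for k b
    using that L by (induction k) (auto simp: distrib_right scaleR_add_left)
  have sumL: "(\<Sum>b\<in>B. real (n b) *\<^sub>R b) \<in> L" for n
    using finB B(3) L(1,2) scale
    by (induction B rule: finite_induct) auto
  have rep: "?rep (f (p, n)) b = ?rep p b + real (n b)" if "b \<in> B" for p n b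
    using that by (simp add: f_def lin representation_sum_scale[OF B(1,2)])
  have cardS: "finite (S p) \<and> card (S p) = (m + DIM('a) - ht p) choose DIM('a)" if "ht p \<le> DIM('a)" for p
  proof (cases "ht p \<le> m")
    case True
    then have "S p = {n. (\<forall>b. b \<notin> B \<longrightarrow> n b = 0) \<and> sum n B \<le> m - ht p}"
      by (auto simp: S_def)
    then show ?thesis
      using card_bounded_compositions[OF finB, of "m - ht p"] cardB True by simp
  next
    case False
    then have "S p = {}"
      by (auto simp: S_def)
    then show ?thesis
      using False that by (simp add: binomial_eq_0)
  qed
  have inj: "inj_on f (SIGMA p:half_open_box B q \<inter> L. S p)"
  proof (rule inj_onI, clarify)
    fix p n p' n'
    assume p: "p \<in> half_open_box B q" "p' \<in> half_open_box B q" and n: "n \<in> S p" "n' \<in> S p'"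
      and eq: "f (p, n) = f (p', n')"
    have *: "?rep p b + real (n b) = ?rep p' b + real (n' b)" if "b \<in> B" for b
      using rep[OF that] eq by metis
    have "n b = n' b" for b
    proof (cases "b \<in> B")
      case True
      \<comment> \<open>Both coordinates lie in the same half-open unit interval, so the integer
        parts must agree.\<close>
      have "\<bar>?rep p b - ?rep p' b\<bar> < 1"
        using p True unfolding half_open_box_def by (auto split: if_splits) force+
      then show ?thesis
        using *[OF True] by linarith
    qed (use n in \<open>auto simp: S_def\<close>)
    then have "n = n'"
      by auto
    with eq show "p = p' \<and> n = n'"
      by (simp add: f_def)
  qed
  have "f ` (SIGMA p:half_open_box B q \<inter> L. S p) =
      {x \<in> half_open_cone B q \<inter> L. (\<Sum>b\<in>B. ?rep x b) \<le> real m}"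
  proof (intro subset_antisym subsetI)
    fix x assume "x \<in> f ` (SIGMA p:half_open_box B q \<inter> L. S p)"
    then obtain p n where p: "p \<in> half_open_box B q" "p \<in> L" "n \<in> S p" "x = f (p, n)"
      by auto
    have "x \<in> L"
      using p L(2) sumL by (auto simp: f_def)
    moreover have "x \<in> half_open_cone B q"
      unfolding half_open_cone_def mem_Collect_eq
    proof
      fix b assume "b \<in> B"
      then have "if ?rep q b > 0 then 0 \<le> ?rep p b else 0 < ?rep p b"
        using p(1) unfolding half_open_box_def by (auto split: if_splits)
      moreover have "?rep x b = ?rep p b + real (n b)"
        using rep[OF \<open>b \<in> B\<close>] p(4) by simp
      ultimately show "?rep x b > 0 \<or> ?rep x b = 0 \<and> ?rep q b > 0"
        by (auto split: if_splits)
    qed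
    moreover have "(\<Sum>b\<in>B. ?rep x b) \<le> real m"
    proof -
      have "(\<Sum>b\<in>B. ?rep x b) = real (ht p + sum n B)"
        using rep h[of p] p by (simp add: sum.distrib)
      also have "\<dots> \<le> real m"
        using p(3) by (simp only: S_def mem_Collect_eq of_nat_le_iff)
      finally show ?thesis .
    qed
    ultimately show "x \<in> {x \<in> half_open_cone B q \<inter> L. (\<Sum>b\<in>B. ?rep x b) \<le> real m}"
      by simp
  next
    fix x assume x: "x \<in> {x \<in> half_open_cone B q \<inter> L. (\<Sum>b\<in>B. ?rep x b) \<le> real m}"
    have "\<exists>k :: nat. if ?rep q b > 0 then 0 \<le> ?rep x b - k \<and> ?rep x b - k < 1
        else 0 < ?rep x b - k \<and> ?rep x b - k \<le> 1" if "b \<in> B" for b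
      using x that ex_half_open_fractional_part[of "?rep x b" "?rep q b > 0"] unfolding half_open_cone_def by auto
    then obtain k where k: "\<And>b. b \<in> B \<Longrightarrow> if ?rep q b > 0 then 0 \<le> ?rep x b - real (k b) \<and> ?rep x b - real (k b) < 1
        else 0 < ?rep x b - real (k b) \<and> ?rep x b - real (k b) \<le> 1"
      by metis
    define n where "n b = (if b \<in> B then k b else 0)" for b
    define p where "p = x - (\<Sum>b\<in>B. real (n b) *\<^sub>R b)"
    have xf: "x = f (p, n)"
      by (simp add: p_def f_def)
    have rp: "?rep p b = ?rep x b - real (k b)" if "b \<in> B" for b
      using rep[OF that, of p n] xf that by (simp add: n_def)
    have "p \<in> L"
      using x L(2)[of x "- (\<Sum>b\<in>B. real (n b) *\<^sub>R b)"] L(3)[OF sumL] by (simp add: p_def)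
    moreover have "p \<in> half_open_box B q"
      unfolding half_open_box_def mem_Collect_eq using k by (intro ballI) (simp only: rp)
    moreover have "n \<in> S p"
    proof -
      have "(\<Sum>b\<in>B. ?rep x b) = (\<Sum>b\<in>B. ?rep p b) + (\<Sum>b\<in>B. real (n b))"
        by (simp add: rp n_def sum.distrib[symmetric])
      then have "real (ht p + sum n B) \<le> real m"
        using x h[of p] calculation by simp
      then show ?thesis
        by (simp only: S_def of_nat_le_iff) (simp add: n_def)
    qed
    ultimately show "x \<in> f ` (SIGMA p:half_open_box B q \<inter> L. S p)"
      using xf by blast
  qed
  then have "card {x \<in> half_open_cone B q \<inter> L. (\<Sum>b\<in>B. ?rep x b) \<le> real m} =
      card (SIGMA p:half_open_box B q \<inter> L. S p)"
    using card_image[OF inj] by simp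
  also have "\<dots> = (\<Sum>p\<in>half_open_box B q \<inter> L. card (S p))"
    using fin cardS ht by (intro card_SigmaI) auto
  also have "\<dots> = (\<Sum>p\<in>half_open_box B q \<inter> L. (m + DIM('a) - ht p) choose DIM('a))"
    using cardS ht by (intro sum.cong) auto
  finally show ?thesis .
qed

text \<open>A coordinate \<open>t\<close> becomes \<open>1 - t\<close>, which exchanges the two
  kinds of half-open intervals. So does passing to \<open>- q\<close>, as no coordinate of a generic
  \<open>q\<close> is zero.\<close>

lemma reflect_half_open_box:
  fixes B :: "'a::euclidean_space set"
  assumes B: "independent B" "span B = UNIV" "B \<subseteq> V" and q: "generic V q"
  shows "\<Sum>B - p \<in> half_open_box B (- q) \<longleftrightarrow> p \<in> half_open_box B q"
    and "(\<Sum>b\<in>B. representation B (\<Sum>B - p) b) = DIM('a) - (\<Sum>b\<in>B. representation B p b)"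
proof -
  have rep: "representation B (\<Sum>B - p) b = 1 - representation B p b" if "b \<in> B" for b
    using representation_sum_scale[OF B(1,2) that, of "\<lambda>_. 1"]
      linear_diff[OF linear_coordinate[OF B(1,2)]] by simp
  have neg: "representation B (- q) b > 0 \<longleftrightarrow> \<not> representation B q b > 0" if "b \<in> B" for b
    using linear_neg[OF linear_coordinate[OF B(1,2)], of q b] generic_representation_nonzero[OF B q that]
    by auto
  show "\<Sum>B - p \<in> half_open_box B (- q) \<longleftrightarrow> p \<in> half_open_box B q"
    unfolding half_open_box_def mem_Collect_eq by (intro ball_cong refl) (auto simp: rep neg)
  show "(\<Sum>b\<in>B. representation B (\<Sum>B - p) b) = DIM('a) - (\<Sum>b\<in>B. representation B p b)"
    by (simp add: rep sum_subtractf card_basis[OF B(1,2)])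
qed

section \<open>Reflexive polytopes\<close>

text \<open>The system is triangular: at \<open>m = j\<close> the terms beyond \<open>j\<close>
  vanish and the term \<open>j\<close> has coefficient \<open>1\<close>.\<close>

lemma binomial_expansion_unique:
  fixes h h' :: "nat \<Rightarrow> nat"
  assumes eq: "\<And>m. (\<Sum>j\<le>d. h j * ((m + d - j) choose d)) = (\<Sum>j\<le>d. h' j * ((m + d - j) choose d))"
    and "j \<le> d"
  shows "h j = h' j"
  using \<open>j \<le> d\<close>
proof (induction j rule: less_induct)
  case (less j)
  have "{..d} = insert j ({..<j} \<union> {j<..d})"
    using less.prems by auto
  then have *: "(\<Sum>i\<le>d. f i * ((j + d - i) choose d)) = f j + (\<Sum>i<j. f i * ((j + d - i) choose d))" for f :: "nat \<Rightarrow> nat"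
  proof -
    have "(\<Sum>i\<in>{j<..d}. f i * ((j + d - i) choose d)) = 0"
      by (intro sum.neutral) (auto intro!: binomial_eq_0)
    then have "(\<Sum>i\<in>{..<j} \<union> {j<..d}. f i * ((j + d - i) choose d)) = (\<Sum>i<j. f i * ((j + d - i) choose d))"
      by (subst sum.union_disjoint) auto
    then show ?thesis
      unfolding \<open>{..d} = _\<close> by (subst sum.insert) auto
  qed
  have "(\<Sum>i<j. h i * ((j + d - i) choose d)) = (\<Sum>i<j. h' i * ((j + d - i) choose d))"
    using less by (intro sum.cong) auto
  then show ?case
    using eq[of j] by (simp add: *)
qed

section \<open>Lattice points and facet normals\<close>

lemma finite_bounded_integer_lattice:
  fixes S :: "(real ^ 'n) set"
  assumes "bounded S"
  shows "finite (S \<inter> integer_lattice)"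
proof -
  obtain K where K: "\<And>x. x \<in> S \<Longrightarrow> norm x \<le> K"
    using assms by (auto simp: bounded_iff)
  let ?f = "\<lambda>f :: 'n \<Rightarrow> int. \<chi> i. real_of_int (f i)"
  have "S \<inter> integer_lattice \<subseteq> ?f ` (UNIV \<rightarrow>\<^sub>E {- \<lceil>K\<rceil>..\<lceil>K\<rceil>})"
  proof
    fix x assume x: "x \<in> S \<inter> integer_lattice"
    have "\<bar>x $ i\<bar> \<le> K" for i
      using K[of x] x component_le_norm_cart[of x i] by auto
    then have "\<lfloor>x $ i\<rfloor> \<in> {- \<lceil>K\<rceil>..\<lceil>K\<rceil>}" for i
      by (smt (verit) atLeastAtMost_iff ceiling_correct floor_correct le_floor_iff of_int_minus floor_le_iff of_int_le_iff)
    moreover have "x = ?f (\<lambda>i. \<lfloor>x $ i\<rfloor>)"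
      using x by (auto simp: vec_eq_iff integer_lattice_def)
    ultimately show "x \<in> ?f ` (UNIV \<rightarrow>\<^sub>E {- \<lceil>K\<rceil>..\<lceil>K\<rceil>})"
      by (intro image_eqI[of _ _ "\<lambda>i. \<lfloor>x $ i\<rfloor>"]) auto
  qed
  then show ?thesis
    by (rule finite_subset) (intro finite_imageI finite_PiE; simp)
qed

lemma integer_lattice_closed:
  fixes x y :: "real ^ 'n"
  shows "0 \<in> (integer_lattice :: (real ^ 'n) set)"
    and "x \<in> integer_lattice \<Longrightarrow> y \<in> integer_lattice \<Longrightarrow> x + y \<in> integer_lattice"
    and "x \<in> integer_lattice \<Longrightarrow> - x \<in> integer_lattice"
    and "x \<in> integer_lattice \<Longrightarrow> y \<in> integer_lattice \<Longrightarrow> x \<bullet> y \<in> \<int>"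
  by (auto simp: integer_lattice_def inner_vec_def intro!: Ints_sum)

context
  fixes P :: "(real ^ 'n) set" and V
  assumes reflexive_P: "reflexive P"
  defines "V \<equiv> {v. v extreme_point_of P}"
begin

lemma polytope_P: "polytope P" and bounded_dual: "bounded (dual_polytope P)"
  using reflexive_P polytope_imp_bounded by (auto simp: reflexive_def lattice_polytope_def)

lemma finite_V: "finite V"
  unfolding V_def by (intro finite_polyhedron_extreme_points polytope_imp_polyhedron polytope_P)

lemma V_lattice: "V \<subseteq> integer_lattice"
  using reflexive_P by (auto simp: reflexive_def lattice_polytope_def V_def)

lemma P_eq_hull: "P = convex hull V"
  unfolding V_def by (intro Krein_Milman_Minkowski polytope_imp_compact polytope_imp_convex polytope_P)

lemma le_on_P:
  assumes "\<And>v. v \<in> V \<Longrightarrow> y \<bullet> v \<le> t" "x \<in> P"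
  shows "y \<bullet> x \<le> t"
proof -
  have "convex hull V \<subseteq> {x. y \<bullet> x \<le> t}"
    using assms(1) by (intro hull_minimal convex_halfspace_le) auto
  then show ?thesis
    using assms(2) P_eq_hull by auto
qed

text \<open>If \<open>a\<close> is nonpositive on \<open>P\<close>, then the ray through \<open>- a\<close> lies in the dual, which is bounded.\<close>

lemma positively_spanning_V: "positively_spanning V"
  unfolding positively_spanning_def
proof (intro allI impI, rule ccontr)
  fix a :: "real ^ 'n" assume "a \<noteq> 0" and neg: "\<not> (\<exists>v\<in>V. a \<bullet> v > 0)"
  have "a \<bullet> v \<le> 0" if "v \<in> V" for v
    using neg that by (meson not_le)
  then have a: "a \<bullet> x \<le> 0" if "x \<in> P" for x
    using that by (rule le_on_P)
  obtain K where K: "\<And>x. x \<in> dual_polytope P \<Longrightarrow> norm x \<le> K"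
    using bounded_dual by (auto simp: bounded_iff)
  define t where "t = (\<bar>K\<bar> + 1) / norm a"
  have "t \<ge> 0"
    by (simp add: t_def)
  then have "t * (a \<bullet> v) \<le> 0" if "v \<in> P" for v
    using a[OF that] by (rule mult_nonneg_nonpos)
  then have "- (t * (a \<bullet> v)) \<ge> - 1" if "v \<in> P" for v
    using that by fastforce
  then have "(- t) *\<^sub>R a \<in> dual_polytope P"
    by (simp add: dual_polytope_def)
  then have "norm ((- t) *\<^sub>R a) \<le> K"
    by (rule K)
  moreover have "norm ((- t) *\<^sub>R a) = \<bar>K\<bar> + 1"
    using \<open>a \<noteq> 0\<close> by (simp add: t_def)
  ultimately show False
    by linarith
qed

lemma zero_in_P: "0 \<in> P"
  using positively_spanning_imp_interior[OF positively_spanning_V] interior_subset P_eq_hull by auto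

text \<open>The dual inequalities given by the spanning set \<open>B\<close> are equalities at
  \<open>- y\<close>. Hence \<open>- y\<close> is a vertex of the dual, and reflexivity makes it
  integral.\<close>

lemma neg_facet_normal_lattice:
  assumes le: "\<And>v. v \<in> V \<Longrightarrow> y \<bullet> v \<le> 1"
    and B: "B \<subseteq> V" "span B = UNIV" "\<And>b. b \<in> B \<Longrightarrow> y \<bullet> b = 1"
  shows "- y \<in> integer_lattice"
proof -
  have "- y \<in> dual_polytope P"
    using le_on_P[of y 1] le by (auto simp: dual_polytope_def)
  \<comment> \<open>On a segment of the dual through \<open>- y\<close>, the product with each
    \<open>b\<close> in \<open>B\<close> has its minimum \<open>- 1\<close> at an inner point, so it
    is constant; as \<open>B\<close> spans, the endpoints coincide.\<close>
  moreover have "- y \<notin> open_segment a b" if ab: "a \<in> dual_polytope P" "b \<in> dual_polytope P" for a b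
  proof
    assume "- y \<in> open_segment a b"
    then obtain s where s: "a \<noteq> b" "0 < s" "s < 1" "- y = (1 - s) *\<^sub>R a + s *\<^sub>R b"
      by (auto simp: in_segment)
    have "a \<bullet> v = b \<bullet> v" if "v \<in> B" for v
    proof -
      have "v \<in> P"
        using that B(1) by (auto simp: V_def extreme_point_of_def)
      then have "a \<bullet> v \<ge> - 1" "b \<bullet> v \<ge> - 1"
        using ab by (auto simp: dual_polytope_def)
      moreover have "(1 - s) * (a \<bullet> v + 1) + s * (b \<bullet> v + 1) = 0"
        using B(3)[OF that] arg_cong[OF s(4), of "\<lambda>x. x \<bullet> v"] by (simp add: inner_add_left algebra_simps)
      ultimately have "(1 - s) * (a \<bullet> v + 1) = 0" "s * (b \<bullet> v + 1) = 0"
        using s(2,3) by (smt (verit) mult_nonneg_nonneg)+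
      then show ?thesis
        using s by simp
    qed
    then have "orthogonal (a - b) v" if "v \<in> B" for v
      using that by (simp add: orthogonal_def inner_diff_left)
    then have "orthogonal (a - b) (a - b)"
      using orthogonal_to_span[of "a - b" B "a - b"] B(2) by auto
    then show False
      using s(1) by (simp add: orthogonal_self)
  qed
  ultimately have "- y extreme_point_of dual_polytope P"
    by (auto simp: extreme_point_of_def)
  then show ?thesis
    using reflexive_P by (auto simp: reflexive_def lattice_polytope_def)
qed

context
  fixes c assumes c: "generic_costs V c"
begin

text \<open>The second property of \<open>c\<close> makes \<open>y\<close> at most \<open>1\<close>
  on all vertices, so an optimal basis lies in a facet with normal \<open>y\<close>, and this normal
  is integral.\<close>

lemma optimal_basis_height:
  assumes "B \<in> optimal_bases V c"
  obtains y where "\<And>x. y \<bullet> x = (\<Sum>b\<in>B. representation B x b)" "\<And>x. x \<in> P \<Longrightarrow> y \<bullet> x \<le> 1"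
    "\<And>x. x \<in> integer_lattice \<Longrightarrow> y \<bullet> x \<in> \<int>"
proof -
  note B = optimal_basesD[OF assms]
  obtain y where y: "\<And>x. y \<bullet> x = (\<Sum>b\<in>B. representation B x b)"
    using ex_inner_eq_sum_representation[OF B(1,2), of "\<lambda>_. 1"] by auto
  have one: "y \<bullet> b = 1" if "b \<in> B" for b
  proof -
    have "y \<bullet> b = (\<Sum>a\<in>B. if b = a then 1 else 0)"
      unfolding y by (intro sum.cong) (auto simp: representation_basis[OF B(1) that])
    then show ?thesis
      using that basis_finite[OF B(1,2)] by simp
  qed
  have le: "y \<bullet> v \<le> 1" if "v \<in> V" for v
  proof (cases "v \<in> B")
    case False
    then show ?thesis
      using generic_costsD(2)[OF c B(3,1,2), of v] B(4)[of v] that by (simp add: y)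
  qed (simp add: one)
  have "- y \<in> integer_lattice"
    using le B(2,3) one by (intro neg_facet_normal_lattice)
  then have "y \<in> integer_lattice"
    using integer_lattice_closed(3) by force
  then show thesis
    using that[of y] y le_on_P[of y 1] le integer_lattice_closed(4) by blast
qed

text \<open>Height is at most \<open>1\<close> on \<open>P\<close>. Conversely, \<open>x\<close>
  divided by its height is a convex combination of \<open>B\<close>, and it may be shrunk towards
  the origin inside \<open>P\<close>.\<close>

lemma mem_dilate_iff_height:
  assumes "B \<in> optimal_bases V c" and x: "x \<in> half_open_cone B q"
  shows "x \<in> (\<lambda>x. real m *\<^sub>R x) ` P \<longleftrightarrow> (\<Sum>b\<in>B. representation B x b) \<le> real m"
proof
  obtain y where y: "\<And>x. y \<bullet> x = (\<Sum>b\<in>B. representation B x b)" "\<And>x. x \<in> P \<Longrightarrow> y \<bullet> x \<le> 1"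
    using optimal_basis_height[OF assms(1)] by metis
  assume "x \<in> (\<lambda>x. real m *\<^sub>R x) ` P"
  then obtain p where "p \<in> P" "x = real m *\<^sub>R p"
    by auto
  then show "(\<Sum>b\<in>B. representation B x b) \<le> real m"
    using y(2)[of p] mult_left_mono[of "y \<bullet> p" 1 "real m"] by (simp flip: y(1))
next
  note B = optimal_basesD[OF assms(1)]
  let ?r = "representation B x"
  assume le: "(\<Sum>b\<in>B. ?r b) \<le> real m"
  have nonneg: "?r b \<ge> 0" if "b \<in> B" for b
    using x that by (force simp: half_open_cone_def)
  show "x \<in> (\<lambda>x. real m *\<^sub>R x) ` P"
  proof (cases "(\<Sum>b\<in>B. ?r b) = 0")
    case True
    then have "\<forall>b\<in>B. ?r b = 0"
      using nonneg basis_finite[OF B(1,2)] by (simp add: sum_nonneg_eq_0_iff)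
    then have "x = 0"
      using sum_representation[OF B(1,2), of x] by simp
    then show ?thesis
      using zero_in_P by (intro image_eqI[of _ _ 0]) auto
  next
    case False
    \<comment> \<open>Positive height forces \<open>m > 0\<close>, so both \<open>s\<close> and
      \<open>m\<close> can be divided by; \<open>m = 0\<close> falls under height zero
      above.\<close>
    define s where "s = (\<Sum>b\<in>B. ?r b)"
    have s: "s > 0" "s \<le> m"
      using False nonneg le sum_nonneg[of B ?r] by (auto simp: s_def)
    have conv: "convex P"
      by (intro polytope_imp_convex polytope_P)
    have "(\<Sum>b\<in>B. (?r b / s) *\<^sub>R b) \<in> P"
      using nonneg s B(3) basis_finite[OF B(1,2)]
      by (intro convex_sum conv) (auto simp: s_def V_def extreme_point_of_def simp flip: sum_divide_distrib)
    also have "(\<Sum>b\<in>B. (?r b / s) *\<^sub>R b) = (1 / s) *\<^sub>R x"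
      by (subst (2) sum_representation[OF B(1,2), of x, symmetric]) (simp add: scaleR_right.sum)
    finally have "(s / m) *\<^sub>R ((1 / s) *\<^sub>R x) + (1 - s / m) *\<^sub>R 0 \<in> P"
      using s zero_in_P by (intro convexD[OF conv]) auto
    then have "(1 / m) *\<^sub>R x \<in> P"
      using s by simp
    then show ?thesis
      using s by (intro image_eqI[of _ _ "(1 / m) *\<^sub>R x"]) auto
  qed
qed

section \<open>The h*-vector as a count of box points\<close>

definition box_count :: "real ^ 'n \<Rightarrow> nat \<Rightarrow> nat" where
  "box_count q j = (\<Sum>B\<in>optimal_bases V c.
     card {p \<in> half_open_box B q \<inter> integer_lattice. (\<Sum>b\<in>B. representation B p b) = real j})"

lemma finite_dilate: "finite ((\<lambda>x. real m *\<^sub>R x) ` P \<inter> integer_lattice)"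
  by (intro finite_bounded_integer_lattice bounded_scaling polytope_imp_bounded polytope_P)

lemma box_height_bounds:
  assumes B: "B \<in> optimal_bases V c" and p: "p \<in> half_open_box B q"
  shows "0 \<le> (\<Sum>b\<in>B. representation B p b)" "(\<Sum>b\<in>B. representation B p b) \<le> CARD('n)"
proof -
  have "0 \<le> representation B p b \<and> representation B p b \<le> 1" if "b \<in> B" for b
    using p that unfolding half_open_box_def by (auto split: if_splits)
  then show "0 \<le> (\<Sum>b\<in>B. representation B p b)" "(\<Sum>b\<in>B. representation B p b) \<le> CARD('n)"
    using sum_bounded_above[of B "representation B p" 1] card_basis[OF optimal_basesD(1,2)[OF B]]
    by (auto intro: sum_nonneg)
qed

lemma box_subset_cone:
  "half_open_box B q \<subseteq> half_open_cone B q"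
proof
  fix x assume x: "x \<in> half_open_box B q"
  have "representation B x b > 0 \<or> representation B x b = 0 \<and> representation B q b > 0" if "b \<in> B" for b
  proof -
    have "if representation B q b > 0 then 0 \<le> representation B x b else 0 < representation B x b"
      using x that unfolding half_open_box_def by (auto split: if_splits)
    then show ?thesis
      by (auto split: if_splits)
  qed
  then show "x \<in> half_open_cone B q"
    by (simp add: half_open_cone_def)
qed

text \<open>The half-open cones partition space, and in each of them membership in the dilate is a
  bound on the height. The resulting sums over box points are grouped by height.\<close>

lemma card_dilate:
  assumes q: "generic V q"
  shows "card ((\<lambda>x. real m *\<^sub>R x) ` P \<inter> integer_lattice) =
    (\<Sum>j\<le>CARD('n). box_count q j * ((m + CARD('n) - j) choose CARD('n)))"
proof -
  let ?L = "integer_lattice :: (real ^ 'n) set"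
  define H where "H B x = (\<Sum>b\<in>B. representation B x b)" for B and x :: "real ^ 'n"
  define C where "C B = {x \<in> half_open_cone B q \<inter> ?L. H B x \<le> real m}" for B
  define X where "X B = half_open_box B q \<inter> ?L" for B
  have fin: "finite (optimal_bases V c)"
    using finite_subset[OF optimal_bases_subset] finite_V by blast
  have ex1: "\<exists>!B. B \<in> optimal_bases V c \<and> x \<in> half_open_cone B q" for x
    by (rule ex1_half_open_cone[OF finite_V positively_spanning_V c q])
  have union: "(\<lambda>x. real m *\<^sub>R x) ` P \<inter> ?L = (\<Union>B\<in>optimal_bases V c. C B)"
  proof (intro set_eqI iffI)
    fix x assume x: "x \<in> (\<lambda>x. real m *\<^sub>R x) ` P \<inter> ?L"
    obtain B where B: "B \<in> optimal_bases V c" "x \<in> half_open_cone B q"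
      using ex1[of x] by (elim ex1E conjE)
    then have "x \<in> C B"
      using x mem_dilate_iff_height[OF B] by (simp add: C_def H_def)
    with B(1) show "x \<in> (\<Union>B\<in>optimal_bases V c. C B)"
      by (rule UN_I)
  next
    fix x assume "x \<in> (\<Union>B\<in>optimal_bases V c. C B)"
    then obtain B where B: "B \<in> optimal_bases V c" "x \<in> C B"
      by (rule UN_E)
    then show "x \<in> (\<lambda>x. real m *\<^sub>R x) ` P \<inter> ?L"
      using mem_dilate_iff_height[OF B(1), of x q m] by (simp add: C_def H_def)
  qed
  have finC: "finite (C B)" if "B \<in> optimal_bases V c" for B
    using finite_subset[OF UN_upper[OF that]] finite_dilate[of m] unfolding union by blast
  \<comment> \<open>Box points have height at most \<open>CARD('n)\<close>, so they lie in a fixed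
    dilate of \<open>P\<close>.\<close>
  have finX: "finite (X B)" if "B \<in> optimal_bases V c" for B
  proof (rule finite_subset)
    show "X B \<subseteq> (\<lambda>x. real CARD('n) *\<^sub>R x) ` P \<inter> ?L"
    proof
      fix p assume p: "p \<in> X B"
      then have "p \<in> half_open_cone B q"
        using box_subset_cone unfolding X_def by blast
      then show "p \<in> (\<lambda>x. real CARD('n) *\<^sub>R x) ` P \<inter> ?L"
        using mem_dilate_iff_height[OF that] box_height_bounds(2)[OF that, of p q] p by (simp add: X_def)
    qed
  qed (rule finite_dilate)
  have cardC: "card (C B) = (\<Sum>j\<le>CARD('n). card {p \<in> X B. H B p = real j} * ((m + CARD('n) - j) choose CARD('n)))"
    if B: "B \<in> optimal_bases V c" for B
  proof -
    note BD = optimal_basesD[OF B]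
    have BL: "B \<subseteq> ?L"
      using BD(3) V_lattice by (rule order_trans)
    define ht where "ht p = nat \<lfloor>H B p\<rfloor>" for p
    have ht: "H B p = real (ht p)" "ht p \<le> CARD('n)" if "p \<in> X B" for p
    proof -
      obtain y where y: "\<And>x. y \<bullet> x = H B x" "\<And>x. x \<in> ?L \<Longrightarrow> y \<bullet> x \<in> \<int>"
        using optimal_basis_height[OF B] unfolding H_def by metis
      then have "H B p \<in> \<int>"
        using that unfolding X_def by (metis IntD2)
      moreover have "0 \<le> H B p" "H B p \<le> CARD('n)"
        using box_height_bounds[OF B] that unfolding X_def H_def by auto
      ultimately show "H B p = real (ht p)" "ht p \<le> CARD('n)"
        unfolding ht_def by (auto simp: Ints_def)
    qed
    have "card (C B) = (\<Sum>p\<in>X B. (m + CARD('n) - ht p) choose CARD('n))"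
      using card_half_open_cone[OF BD(1,2) BL integer_lattice_closed(1,2,3) finX[OF B, unfolded X_def], of ht m] ht
      unfolding C_def H_def X_def by simp
    also have "\<dots> = (\<Sum>j\<le>CARD('n). \<Sum>p\<in>{p \<in> X B. ht p = j}. (m + CARD('n) - ht p) choose CARD('n))"
      using ht finX[OF B] by (intro sum.group[symmetric]) auto
    also have "\<dots> = (\<Sum>j\<le>CARD('n). card {p \<in> X B. ht p = j} * ((m + CARD('n) - j) choose CARD('n)))"
      by (intro sum.cong) auto
    also have "\<dots> = (\<Sum>j\<le>CARD('n). card {p \<in> X B. H B p = real j} * ((m + CARD('n) - j) choose CARD('n)))"
      using ht by (intro sum.cong refl arg_cong2[where f = "(*)"] arg_cong[where f = card]) auto
    finally show ?thesis .
  qed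
  have "card (\<Union>B\<in>optimal_bases V c. C B) = (\<Sum>B\<in>optimal_bases V c. card (C B))"
  proof (rule card_UN_disjoint[OF fin])
    show "\<forall>B\<in>optimal_bases V c. finite (C B)"
      using finC by blast
    show "\<forall>B\<in>optimal_bases V c. \<forall>B'\<in>optimal_bases V c. B \<noteq> B' \<longrightarrow> C B \<inter> C B' = {}"
      using ex1 unfolding C_def by fast
  qed
  also have "\<dots> = (\<Sum>j\<le>CARD('n). box_count q j * ((m + CARD('n) - j) choose CARD('n)))"
    unfolding box_count_def sum_distrib_right
    by (subst sum.swap) (intro sum.cong refl, simp add: cardC X_def H_def)
  finally show ?thesis
    unfolding union .
qed

text \<open>The reflection of box points preserves the lattice because \<open>\<Sum>B\<close> is a
  lattice point.\<close>

lemma box_count_reflect: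
  assumes q: "generic V q" and "j \<le> CARD('n)"
  shows "box_count (- q) (CARD('n) - j) = box_count q j"
  unfolding box_count_def
proof (rule sum.cong[OF refl])
  fix B assume B: "B \<in> optimal_bases V c"
  note BD = optimal_basesD[OF B]
  note r = reflect_half_open_box[OF BD(1,2,3) q]
  have "\<Sum>B \<in> integer_lattice"
    using basis_finite[OF BD(1,2)] BD(3) V_lattice integer_lattice_closed(1,2)
    by (induction B rule: finite_induct) auto
  then have L: "\<Sum>B - p \<in> integer_lattice \<longleftrightarrow> p \<in> integer_lattice" for p
    using integer_lattice_closed(2)[of "\<Sum>B" "- p"] integer_lattice_closed(2)[of "\<Sum>B" "- (\<Sum>B - p)"]
      integer_lattice_closed(3)[of p] integer_lattice_closed(3)[of "\<Sum>B - p"] by auto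
  have "bij_betw (\<lambda>p. \<Sum>B - p)
      {p \<in> half_open_box B q \<inter> integer_lattice. (\<Sum>b\<in>B. representation B p b) = real j}
      {p \<in> half_open_box B (- q) \<inter> integer_lattice. (\<Sum>b\<in>B. representation B p b) = real (CARD('n) - j)}"
    using assms(2) L r(1) r(1)[of "\<Sum>B - _"] r(2)
    by (intro bij_betw_byWitness[where f' = "\<lambda>p. \<Sum>B - p"]) (auto simp: of_nat_diff)
  then show "card {p \<in> half_open_box B (- q) \<inter> integer_lattice. (\<Sum>b\<in>B. representation B p b) = real (CARD('n) - j)} =
      card {p \<in> half_open_box B q \<inter> integer_lattice. (\<Sum>b\<in>B. representation B p b) = real j}"
    by (rule bij_betw_same_card[symmetric])
qed

end

text \<open>The formulas for \<open>q\<close> and \<open>- q\<close> count the same points, so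
  uniqueness of the expansion identifies the two vectors, and the reflection becomes a symmetry of
  one vector.\<close>

lemma ex_symmetric_hstar:
  obtains h where "h 0 = (1 :: nat)" "\<And>j. j \<le> CARD('n) \<Longrightarrow> h (CARD('n) - j) = h j"
    "\<And>m. card ((\<lambda>x. real m *\<^sub>R x) ` P \<inter> integer_lattice) =
      (\<Sum>j\<le>CARD('n). h j * ((m + CARD('n) - j) choose CARD('n)))"
proof -
  obtain c where c: "generic_costs V c"
    using ex_generic_costs[OF finite_V] by blast
  obtain q where q: "generic V q"
    using ex_generic[OF finite_V] by blast
  then have q': "generic V (- q)"
    by (simp add: generic_uminus)
  let ?h = "box_count c q"
  have "?h j = box_count c (- q) j" if "j \<le> CARD('n)" for j
    by (rule binomial_expansion_unique[OF _ that])
       (rule trans[OF card_dilate[OF c q, symmetric] card_dilate[OF c q']])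
  then have "?h (CARD('n) - j) = ?h j" if "j \<le> CARD('n)" for j
    using box_count_reflect[OF c q that] that by simp
  moreover have "?h 0 = 1"
  proof -
    \<comment> \<open>At \<open>m = 0\<close> the dilate is the origin alone and only the term
      \<open>j = 0\<close> survives.\<close>
    have zero: "(\<lambda>x. real 0 *\<^sub>R x) ` P \<inter> integer_lattice = {0}"
      using zero_in_P integer_lattice_closed(1) by auto
    have "(\<Sum>j\<le>CARD('n). ?h j * ((0 + CARD('n) - j) choose CARD('n))) = 1"
      using card_dilate[OF c q, of 0] unfolding zero by simp
    moreover have "(\<Sum>j\<le>CARD('n). ?h j * ((0 + CARD('n) - j) choose CARD('n))) = (\<Sum>j\<in>{0}. ?h j)"
      by (rule sum.mono_neutral_cong_right) (auto simp: binomial_eq_0)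
    ultimately show ?thesis
      by simp
  qed
  ultimately show thesis
    using that[of ?h] card_dilate[OF c q] by blast
qed

end

theorem theorem1p7:
  fixes P :: "(real ^ 'n) set" and z :: complex
  assumes "reflexive P"
    and "poly (ehrhart_polynomial P) z = 0"
    and "CARD('n) \<le> 5 \<or> real_polytope P"
  shows "- (real CARD('n) / 2) \<le> Re z \<and> Re z \<le> real CARD('n) / 2 - 1"
proof -
  obtain h where h: "h 0 = (1 :: nat)" "\<And>j. j \<le> CARD('n) \<Longrightarrow> h (CARD('n) - j) = h j"
    "\<And>m. card ((\<lambda>x. real m *\<^sub>R x) ` P \<inter> integer_lattice) =
      (\<Sum>j\<le>CARD('n). h j * ((m + CARD('n) - j) choose CARD('n)))"
    using ex_symmetric_hstar[OF assms(1)] by blast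
  \<comment> \<open>Since \<open>h 0 = 1\<close>, the sum is positive, as the degree computation
    requires.\<close>
  have "(\<Sum>j\<le>CARD('n). h j) \<ge> h 0"
    by (intro member_le_sum) auto
  then have "is_ehrhart_polynomial P (hstar_poly CARD('n) h)"
    unfolding is_ehrhart_polynomial_def
    by (simp only: degree_hstar_poly poly_hstar_poly_of_nat h) simp
  then have L: "ehrhart_polynomial P = hstar_poly CARD('n) h"
    unfolding ehrhart_polynomial_def by (intro the_equality is_ehrhart_polynomial_unique)
  moreover have "CARD('n) \<le> 5 \<or> Im z = 0"
    using assms(2,3) by (auto simp: real_polytope_def)
  ultimately show ?thesis
    using hstar_poly_root_bounds[of "CARD('n)" h z] h assms(2) by simp
qed

end
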